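(* Let $\lambda>0$ and $(T,x,c)\in(0,\infty)\times\mathbb R^2$, and let $$w(T,x,c):=\inf_{u\in U(T,x,c)}\mathbb E\left[\int_0^T\left(e^{\lambda|u_t|}-1\right)dt\right].$$ Then $$w(T,x,c)=T\left(e^{\frac{\lambda(1-x)^+}{T}}-1\right),$$ and the unique optimal control (i.e. the unique $u\in U(T,x,c)$, up to $dt\otimes\mathbb P$-null sets, attaining the infimum) is given by $u=\frac{(1-x)^+}{T}$ $dt\otimes\mathbb P$-a.s.
   Context: $(\Omega,\mathcal F,\mathbb P)$ is a complete probability space carrying a standard one-dimensional Brownian motion $W=(W_t)_{t\ge0}$, with filtration $\mathcal F^W_t=\sigma\{W_u:u\le t\}$ completed by the null sets; progressive measurability is with respect to this filtration. $\mathbb I_Q$ is the indicator of the event $Q$, and $(a)^+=\max(a,0)$. For $(T,x)\in(0,\infty)\times\mathbb R$ and a progressively measurable process $u=\{u_t\}_{t=0}^T$ with $\int_0^T|u_t|\,dt<\infty$ a.s., set $X^{x,u}_t:=x+\int_0^tu_s\,ds$, $t\in[0,T]$. For $(T,x,c)\in(0,\infty)\times\mathbb R^2$, $U(T,x,c)$ is the set of all such $u$ satisfying $X^{x,u}_T\ge\mathbb I_{W_T>c}$ a.s. *)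

theory Defs
  imports "HOL-Probability.Probability"
begin

text \<open>Time is indexed by \<^typ>\<open>real\<close>; only times \<open>t \<ge> 0\<close> are constrained.  The times in the
  independence axiom are weakly increasing; repeated times only add the increment 0.\<close>

locale standard_brownian_motion = prob_space M
  for M :: "'a measure" +
  fixes W :: "real \<Rightarrow> 'a \<Rightarrow> real"
  assumes measurable_W: "\<And>t. 0 \<le> t \<Longrightarrow> W t \<in> borel_measurable M"
    and start_zero: "AE \<omega> in M. W 0 \<omega> = 0"
    and continuous_paths: "AE \<omega> in M. continuous_on {0..} (\<lambda>t. W t \<omega>)"
    and normal_increments: "\<And>s t. 0 \<le> s \<Longrightarrow> s < t \<Longrightarrow>
      distributed M lborel (\<lambda>\<omega>. W t \<omega> - W s \<omega>) (normal_density 0 (sqrt (t - s)))"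
    and independent_increments: "\<And>(\<tau> :: nat \<Rightarrow> real) n. 0 \<le> \<tau> 0 \<Longrightarrow> (\<And>i. i < n \<Longrightarrow> \<tau> i \<le> \<tau> (Suc i)) \<Longrightarrow>
      indep_vars (\<lambda>_. borel) (\<lambda>i \<omega>. W (\<tau> (Suc i)) \<omega> - W (\<tau> i) \<omega>) {..<n}"

definition augmented_filtration :: "'a measure \<Rightarrow> (real \<Rightarrow> 'a \<Rightarrow> real) \<Rightarrow> real \<Rightarrow> 'a measure" where
  "augmented_filtration M W t =
    sigma (space M)
      ({W s -` A \<inter> space M | s A. 0 \<le> s \<and> s \<le> t \<and> A \<in> sets borel} \<union> null_sets M)"

definition progressively_measurable ::
  "(real \<Rightarrow> 'a measure) \<Rightarrow> real \<Rightarrow> (real \<Rightarrow> 'a \<Rightarrow> real) \<Rightarrow> bool" where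
  "progressively_measurable F T u \<longleftrightarrow>
    (\<forall>t\<in>{0..T}. (\<lambda>(s, \<omega>). u s \<omega>) \<in> borel_measurable (restrict_space borel {0..t} \<Otimes>\<^sub>M F t))"

definition controlled_state :: "real \<Rightarrow> (real \<Rightarrow> 'a \<Rightarrow> real) \<Rightarrow> real \<Rightarrow> 'a \<Rightarrow> real" where
  "controlled_state x u t \<omega> = x + (LINT s:{0..t}|lborel. u s \<omega>)"

definition admissible ::
  "'a measure \<Rightarrow> (real \<Rightarrow> 'a \<Rightarrow> real) \<Rightarrow> real \<Rightarrow> real \<Rightarrow> real \<Rightarrow> (real \<Rightarrow> 'a \<Rightarrow> real) set" where
  "admissible M W T x c =
    {u. progressively_measurable (augmented_filtration M W) T u \<and>
        (AE \<omega> in M. (\<integral>\<^sup>+t\<in>{0..T}. ennreal \<bar>u t \<omega>\<bar> \<partial>lborel) < \<infinity>) \<and>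
        (AE \<omega> in M. controlled_state x u T \<omega> \<ge> indicator {\<omega>'. W T \<omega>' > c} \<omega>)}"

text \<open>The cost is a nonnegative extended real, as it may be infinite for an admissible control.\<close>

definition expected_cost :: "'a measure \<Rightarrow> real \<Rightarrow> real \<Rightarrow> (real \<Rightarrow> 'a \<Rightarrow> real) \<Rightarrow> ennreal" where
  "expected_cost M lam T u =
    (\<integral>\<^sup>+\<omega>. (\<integral>\<^sup>+t\<in>{0..T}. ennreal (exp (lam * \<bar>u t \<omega>\<bar>) - 1) \<partial>lborel) \<partial>M)"

definition value_function ::
  "'a measure \<Rightarrow> (real \<Rightarrow> 'a \<Rightarrow> real) \<Rightarrow> real \<Rightarrow> real \<Rightarrow> real \<Rightarrow> real \<Rightarrow> ennreal" where
  "value_function M W lam T x c = (INF u\<in>admissible M W T x c. expected_cost M lam T u)"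

definition optimal_control ::
  "'a measure \<Rightarrow> (real \<Rightarrow> 'a \<Rightarrow> real) \<Rightarrow> real \<Rightarrow> real \<Rightarrow> real \<Rightarrow> real \<Rightarrow> (real \<Rightarrow> 'a \<Rightarrow> real) \<Rightarrow> bool" where
  "optimal_control M W lam T x c u \<longleftrightarrow>
    u \<in> admissible M W T x c \<and> expected_cost M lam T u = value_function M W lam T x c"

end

theory Submission
  imports Defs "HOL-Real_Asymp.Real_Asymp"
begin

text \<open>Write \<open>g = (1 - x)\<^sup>+\<close> and \<open>K = exp (lam g / T)\<close>.  The Young inequality
  \<open>a z \<le> (exp a - 1) + (z ln z - z + 1)\<close> with \<open>a = lam \<bar>u t\<bar>\<close> and \<open>z = K Z t\<close>, for the density process
  \<open>Z\<close> of a measure \<open>Q\<close>, bounds the cost from below by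
  \<open>T (K - 1) - lam K g Q(W T \<le> c) - K \<integral> H(t) dt\<close>, where \<open>H(t)\<close> is the relative entropy of \<open>Q\<close> on the
  information up to \<open>t\<close>.  A drift of order \<open>1 / (T - t)\<close> that accelerates towards \<open>T\<close> makes
  \<open>Q(W T \<le> c)\<close> and \<open>\<integral> H(t) dt\<close> arbitrarily small simultaneously: because of the logarithmic divergence
  of \<open>\<integral> dt / (T - t)\<close>, a fixed displacement of \<open>W\<close> has vanishing price.  The constant control attains
  the limit \<open>T (K - 1)\<close>, and uniqueness follows from strict convexity applied to the midpoint of an
  optimal control and the constant one.\<close>

subsection \<open>Independence of increments from the completed filtration\<close>

context standard_brownian_motion
begin

abbreviation increment :: "real \<Rightarrow> real \<Rightarrow> 'a \<Rightarrow> real" where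
  "increment s t \<omega> \<equiv> W t \<omega> - W s \<omega>"

abbreviation cylinder :: "real set \<Rightarrow> (real \<Rightarrow> real set) \<Rightarrow> 'a set" where
  "cylinder S A \<equiv> {\<omega> \<in> space M. \<forall>s\<in>S. W s \<omega> \<in> A s}"

lemma cylinder_events:
  assumes "finite S" "S \<subseteq> {0..}" "\<And>s. A s \<in> sets borel"
  shows "cylinder S A \<in> events"
proof -
  have "{\<omega> \<in> space M. W s \<omega> \<in> A s} \<in> events" if "s \<in> S" for s
    using measurable_sets[OF measurable_W[of s] assms(3)[of s]] that assms(2)
    by (auto simp: vimage_def Int_def conj_commute)
  then show ?thesis
    using assms(1) by (rule sets.sets_Collect_finite_All)
qed

lemma increment_measurable:
  "0 \<le> s \<Longrightarrow> 0 \<le> t \<Longrightarrow> increment s t \<in> borel_measurable M"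
  using measurable_W by simp

text \<open>Up to the almost surely vanishing \<open>W 0\<close>, the values of \<open>W\<close> at
  the times in \<open>S\<close> are partial sums of increments over a grid of \<open>[0, t]\<close>.
  The increment over \<open>[t, r]\<close> prolongs this family by one member, so independence of
  disjoint blocks of increments applies.\<close>

lemma cylinder_indep_increment:
  assumes t: "0 \<le> t" "t < r" and S: "finite S" "S \<subseteq> {0..t}"
    and A: "\<And>s. A s \<in> sets borel" and B: "B \<in> sets borel"
  shows "prob (cylinder S A \<inter> {\<omega> \<in> space M. increment t r \<omega> \<in> B})
    = prob (cylinder S A) * prob {\<omega> \<in> space M. increment t r \<omega> \<in> B}"
proof -
  let ?R = "insert 0 (insert t S)"
  define l where "l = sorted_list_of_set ?R"
  define n where "n = length l - 1"
  \<comment> \<open>Adjoining 0 and \<open>t\<close> to \<open>S\<close> makes the grid start at 0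
    and puts \<open>t\<close> at position \<open>n\<close>. Since \<open>r\<close> comes next,
    increment number \<open>n\<close> is the one from \<open>t\<close> to \<open>r\<close>.\<close>
  define \<tau> where "\<tau> i = (if i \<le> n then l ! i else r)" for i
  have set_l: "set l = ?R" and sorted_l: "sorted l"
    using S by (simp_all add: l_def del: sorted_list_of_set_insert_remove)
  have len: "length l = Suc n"
    using set_l unfolding n_def by (cases l) auto
  have l_range: "0 \<le> l ! i \<and> l ! i \<le> t" if "i \<le> n" for i
  proof -
    have "l ! i \<in> ?R" using that len set_l nth_mem[of i l] by auto
    then show ?thesis using S t by auto
  qed
  have ex_idx: "\<exists>i\<le>n. l ! i = s" if "s \<in> ?R" for s
    using that set_l len by (metis in_set_conv_nth less_Suc_eq_le)
  have l0: "l ! 0 = 0"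
  proof -
    obtain i where "i \<le> n" "l ! i = 0" using ex_idx[of 0] by auto
    then have "l ! 0 \<le> 0" using sorted_nth_mono[OF sorted_l, of 0 i] len by auto
    then show ?thesis using l_range[of 0] by auto
  qed
  have ln: "l ! n = t"
  proof -
    obtain i where "i \<le> n" "l ! i = t" using ex_idx[of t] by auto
    then have "t \<le> l ! n" using sorted_nth_mono[OF sorted_l, of i n] len by auto
    then show ?thesis using l_range[of n] by auto
  qed
  have \<tau>_mono: "\<tau> i \<le> \<tau> (Suc i)" if "i < Suc n" for i
  proof (cases "i < n")
    case True
    then show ?thesis using sorted_nth_mono[OF sorted_l, of i "Suc i"] len by (simp add: \<tau>_def)
  next
    case False
    then have "i = n" using that by simp
    then show ?thesis using ln t by (simp add: \<tau>_def)
  qed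
  define D where "D i \<omega> = W (\<tau> (Suc i)) \<omega> - W (\<tau> i) \<omega>" for i \<omega>
  have "indep_vars (\<lambda>_. borel) D {..<Suc n}"
    unfolding D_def using \<tau>_mono l0 by (intro independent_increments) (auto simp: \<tau>_def)
  then have ind: "indep_var (PiM {..<n} (\<lambda>_. borel)) (\<lambda>\<omega>. restrict (\<lambda>i. D i \<omega>) {..<n})
      (PiM {n} (\<lambda>_. borel)) (\<lambda>\<omega>. restrict (\<lambda>i. D i \<omega>) {n})"
    by (intro indep_var_restrict[where I="{..<Suc n}"]) auto
  have "\<forall>s. \<exists>i. s \<in> S \<longrightarrow> i \<le> n \<and> l ! i = s" using ex_idx by auto
  then obtain k where k: "\<And>s. s \<in> S \<Longrightarrow> k s \<le> n \<and> l ! k s = s" by metis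
  have tele: "W s \<omega> - W 0 \<omega> = (\<Sum>j<k s. D j \<omega>)" if "s \<in> S" for s \<omega>
    using k[OF that] l0 sum_lessThan_telescope[of "\<lambda>j. W (\<tau> j) \<omega>" "k s"] by (simp add: D_def \<tau>_def)
  have Dn: "D n = increment t r" by (simp add: fun_eq_iff D_def \<tau>_def ln)
  let ?P = "PiM {..<n} (\<lambda>_. borel :: real measure)"
  define Xa where "Xa = {f \<in> space ?P. \<forall>s\<in>S. (\<Sum>j<k s. f j) \<in> A s}"
  define Xb where "Xb = {f \<in> space (PiM {n} (\<lambda>_. borel :: real measure)). f n \<in> B}"
  have "Xa \<in> sets ?P"
    unfolding Xa_def
  proof (rule sets.sets_Collect_finite_All[OF _ S(1)])
    fix s assume s: "s \<in> S"
    have "(\<lambda>f. \<Sum>j<k s. f j) \<in> borel_measurable ?P"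
      using k[OF s] by (intro borel_measurable_sum measurable_component_singleton) auto
    from measurable_sets[OF this A[of s]]
    show "{f \<in> space ?P. (\<Sum>j<k s. f j) \<in> A s} \<in> sets ?P"
      by (auto simp: vimage_def Int_def conj_commute)
  qed
  moreover have "Xb \<in> sets (PiM {n} (\<lambda>_. borel :: real measure))"
    using B unfolding Xb_def by measurable
  ultimately have eq: "prob ((\<lambda>\<omega>. (restrict (\<lambda>i. D i \<omega>) {..<n}, restrict (\<lambda>i. D i \<omega>) {n})) -` (Xa \<times> Xb) \<inter> space M)
      = prob ((\<lambda>\<omega>. restrict (\<lambda>i. D i \<omega>) {..<n}) -` Xa \<inter> space M)
        * prob ((\<lambda>\<omega>. restrict (\<lambda>i. D i \<omega>) {n}) -` Xb \<inter> space M)"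
    by (intro indep_varD[OF ind])
  define E where "E = {\<omega> \<in> space M. \<forall>s\<in>S. (\<Sum>j<k s. D j \<omega>) \<in> A s}"
  have sum_restrict: "(\<Sum>j<k s. restrict (\<lambda>i. D i \<omega>) {..<n} j) = (\<Sum>j<k s. D j \<omega>)" if "s \<in> S" for s \<omega>
    using k[OF that] by (intro sum.cong) auto
  have pre_a: "(\<lambda>\<omega>. restrict (\<lambda>i. D i \<omega>) {..<n}) -` Xa \<inter> space M = E"
  proof (rule set_eqI)
    fix \<omega>
    have "restrict (\<lambda>i. D i \<omega>) {..<n} \<in> space ?P" by (simp add: space_PiM)
    then show "\<omega> \<in> (\<lambda>\<omega>. restrict (\<lambda>i. D i \<omega>) {..<n}) -` Xa \<inter> space M \<longleftrightarrow> \<omega> \<in> E"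
      unfolding Xa_def E_def vimage_eq Int_iff mem_Collect_eq using sum_restrict by metis
  qed
  have pre_b: "(\<lambda>\<omega>. restrict (\<lambda>i. D i \<omega>) {n}) -` Xb \<inter> space M = {\<omega> \<in> space M. increment t r \<omega> \<in> B}"
    by (auto simp: Xb_def space_PiM Dn)
  have "(\<lambda>\<omega>. (restrict (\<lambda>i. D i \<omega>) {..<n}, restrict (\<lambda>i. D i \<omega>) {n})) -` (Xa \<times> Xb) \<inter> space M
      = ((\<lambda>\<omega>. restrict (\<lambda>i. D i \<omega>) {..<n}) -` Xa \<inter> space M) \<inter> ((\<lambda>\<omega>. restrict (\<lambda>i. D i \<omega>) {n}) -` Xb \<inter> space M)"
    by auto
  with eq have main: "prob (E \<inter> {\<omega> \<in> space M. increment t r \<omega> \<in> B})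
      = prob E * prob {\<omega> \<in> space M. increment t r \<omega> \<in> B}"
    unfolding pre_a pre_b by simp
  \<comment> \<open>Telescoping yields \<open>W s - W 0\<close>, and \<open>W 0\<close> vanishes
    only almost surely, so the cylinder and \<open>E\<close> are compared modulo a null set.\<close>
  have AE: "AE \<omega> in M. \<omega> \<in> cylinder S A \<longleftrightarrow> \<omega> \<in> E"
    using start_zero
  proof eventually_elim
    case (elim \<omega>)
    then have "W s \<omega> = (\<Sum>j<k s. D j \<omega>)" if "s \<in> S" for s using tele[OF that, of \<omega>] by simp
    then show ?case by (auto simp: E_def)
  qed
  have E_ev: "E \<in> events"
    using measurable_sets[OF indep_var_rv1[OF ind] \<open>Xa \<in> sets ?P\<close>] by (simp add: pre_a)
  have B_ev: "{\<omega> \<in> space M. increment t r \<omega> \<in> B} \<in> events"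
    using measurable_sets[OF increment_measurable[of t r] B] t by (auto simp: vimage_def Int_def conj_commute)
  have C_ev: "cylinder S A \<in> events"
    using S A by (intro cylinder_events) auto
  have "prob (cylinder S A) = prob E"
    using AE C_ev E_ev by (rule finite_measure_eq_AE)
  moreover have "prob (cylinder S A \<inter> {\<omega> \<in> space M. increment t r \<omega> \<in> B})
      = prob (E \<inter> {\<omega> \<in> space M. increment t r \<omega> \<in> B})"
  proof (rule finite_measure_eq_AE)
    show "AE \<omega> in M. \<omega> \<in> cylinder S A \<inter> {\<omega> \<in> space M. increment t r \<omega> \<in> B}
        \<longleftrightarrow> \<omega> \<in> E \<inter> {\<omega> \<in> space M. increment t r \<omega> \<in> B}"
      using AE by eventually_elim blast
  qed (intro sets.Int C_ev E_ev B_ev)+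
  ultimately show ?thesis using main by simp
qed

section \<open>The completed filtration and its generators modulo null sets\<close>

abbreviation \<F> :: "real \<Rightarrow> 'a measure" where
  "\<F> \<equiv> augmented_filtration M W"

text \<open>Working modulo null sets keeps the generators of the completed filtration stable under
  intersection, and lets \<open>W 0\<close> be treated as 0.\<close>
definition cylinders_mod_null :: "real \<Rightarrow> 'a set set" where
  "cylinders_mod_null t = {E \<in> events. \<exists>S A. finite S \<and> S \<subseteq> {0..t} \<and> (\<forall>s. A s \<in> sets borel)
     \<and> (AE \<omega> in M. \<omega> \<in> E \<longleftrightarrow> \<omega> \<in> cylinder S A)}"

lemma cylinders_mod_nullI:
  "E \<in> events \<Longrightarrow> finite S \<Longrightarrow> S \<subseteq> {0..t} \<Longrightarrow> (\<And>s. A s \<in> sets borel) \<Longrightarrow>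
    (AE \<omega> in M. \<omega> \<in> E \<longleftrightarrow> \<omega> \<in> cylinder S A) \<Longrightarrow> E \<in> cylinders_mod_null t"
  unfolding cylinders_mod_null_def by blast

lemma cylinders_mod_nullE:
  assumes "E \<in> cylinders_mod_null t"
  obtains S A where "E \<in> events" "finite S" "S \<subseteq> {0..t}" "\<forall>s. A s \<in> sets borel"
    "AE \<omega> in M. \<omega> \<in> E \<longleftrightarrow> \<omega> \<in> cylinder S A"
  using assms unfolding cylinders_mod_null_def
  by (elim CollectE conjE exE) (rule that)

lemma cylinders_mod_null_events: "cylinders_mod_null t \<subseteq> events"
  by (simp add: cylinders_mod_null_def)

lemma Int_stable_cylinders_mod_null: "Int_stable (cylinders_mod_null t)"
proof (rule Int_stableI)
  fix E E' assume E_in: "E \<in> cylinders_mod_null t" and E'_in: "E' \<in> cylinders_mod_null t"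
  obtain S A where E: "E \<in> events" "finite S" "S \<subseteq> {0..t}" "\<forall>s. A s \<in> sets borel"
      "AE \<omega> in M. \<omega> \<in> E \<longleftrightarrow> \<omega> \<in> cylinder S A"
    using E_in by (rule cylinders_mod_nullE)
  obtain S' A' where E': "E' \<in> events" "finite S'" "S' \<subseteq> {0..t}" "\<forall>s. A' s \<in> sets borel"
      "AE \<omega> in M. \<omega> \<in> E' \<longleftrightarrow> \<omega> \<in> cylinder S' A'"
    using E'_in by (rule cylinders_mod_nullE)
  \<comment> \<open>A time constrained by only one of the two cylinders receives \<open>UNIV\<close>
    from the other, so both become cylinders over the common index set.\<close>
  let ?A = "\<lambda>s. (if s \<in> S then A s else UNIV) \<inter> (if s \<in> S' then A' s else UNIV)"
  show "E \<inter> E' \<in> cylinders_mod_null t"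
  proof (rule cylinders_mod_nullI)
    show "AE \<omega> in M. \<omega> \<in> E \<inter> E' \<longleftrightarrow> \<omega> \<in> cylinder (S \<union> S') ?A"
      using E(5) E'(5)
    proof eventually_elim
      case (elim \<omega>)
      have "(\<forall>s\<in>S \<union> S'. W s \<omega> \<in> ?A s) \<longleftrightarrow> (\<forall>s\<in>S. W s \<omega> \<in> A s) \<and> (\<forall>s\<in>S'. W s \<omega> \<in> A' s)"
        by auto
      with elim show ?case by blast
    qed
    show "?A s \<in> sets borel" for s using E(4) E'(4) by simp
  qed (use E(1-3) E'(1-3) in auto)
qed

lemma filtration_generators_subset:
  assumes "0 \<le> t"
  shows "{W s -` A \<inter> space M | s A. 0 \<le> s \<and> s \<le> t \<and> A \<in> sets borel} \<union> null_sets M \<subseteq> cylinders_mod_null t"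
proof (intro Un_least subsetI)
  fix E assume "E \<in> {W s -` A \<inter> space M | s A. 0 \<le> s \<and> s \<le> t \<and> A \<in> sets borel}"
  then obtain s A where E: "E = W s -` A \<inter> space M" "0 \<le> s" "s \<le> t" "A \<in> sets borel" by blast
  then have "E \<in> events" by (auto intro: measurable_sets measurable_W)
  then show "E \<in> cylinders_mod_null t"
    by (rule cylinders_mod_nullI[where S="{s}" and A="\<lambda>_. A"]) (use E in auto)
next
  fix E assume "E \<in> null_sets M"
  then have "E \<in> events" and "AE \<omega> in M. \<omega> \<notin> E" by (auto intro: AE_not_in)
  \<comment> \<open>A null set is almost surely the empty cylinder, produced by the impossible
    constraint \<open>{}\<close> at time 0.\<close>
  then show "E \<in> cylinders_mod_null t"
    by (intro cylinders_mod_nullI[where S="{0}" and A="\<lambda>_. {}"]) (use assms in auto)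
qed

lemma space_filtration [simp]: "space (\<F> t) = space M"
  by (simp add: augmented_filtration_def space_measure_of_conv)

lemma sets_filtration:
  "sets (\<F> t) = sigma_sets (space M)
     ({W s -` A \<inter> space M | s A. 0 \<le> s \<and> s \<le> t \<and> A \<in> sets borel} \<union> null_sets M)"
  unfolding augmented_filtration_def
  by (intro sets_measure_of) (auto dest: sets.sets_into_space null_setsD2)

lemma sets_filtration_mono: "s \<le> t \<Longrightarrow> sets (\<F> s) \<subseteq> sets (\<F> t)"
  unfolding sets_filtration by (intro sigma_sets_subseteq) fastforce

lemma sets_filtration_subset: "0 \<le> t \<Longrightarrow> sets (\<F> t) \<subseteq> events"
  unfolding sets_filtration
  by (intro sets.sigma_sets_subset order_trans[OF filtration_generators_subset cylinders_mod_null_events])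

lemma measurable_filtration_mono:
  "X \<in> measurable (\<F> s) N \<Longrightarrow> s \<le> t \<Longrightarrow> X \<in> measurable (\<F> t) N"
  using sets_filtration_mono[of s t] by (auto simp: measurable_def)

lemma measurable_filtration_M:
  "X \<in> measurable (\<F> t) N \<Longrightarrow> 0 \<le> t \<Longrightarrow> X \<in> measurable M N"
  using sets_filtration_subset[of t] by (auto simp: measurable_def)

lemma W_adapted: "0 \<le> s \<Longrightarrow> s \<le> t \<Longrightarrow> W s \<in> borel_measurable (\<F> t)"
  by (rule measurableI) (auto simp: sets_filtration intro!: sigma_sets.Basic)

text \<open>Cylinders modulo null sets are stable under intersection and generate a sigma-algebra
  containing \<open>\<F> t\<close>. Replacing such an event by its cylinder changes no probability,
  so it is independent of the increment, and independence passes from the generators to the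
  generated sigma-algebras.\<close>

lemma indep_var_increment:
  assumes t: "0 \<le> t" "t < r" and X: "X \<in> measurable (\<F> t) N" and g: "g \<in> measurable borel N'"
  shows "indep_var N X N' (\<lambda>\<omega>. g (increment t r \<omega>))"
proof -
  let ?B = "{increment t r -` B \<inter> space M | B. B \<in> sets borel}"
  have rv: "increment t r \<in> borel_measurable M" using t by (intro increment_measurable) auto
  have "indep_set (cylinders_mod_null t) ?B"
  proof (rule indep_setI)
    show "?B \<subseteq> events" using rv by (auto intro: measurable_sets)
    fix E D assume "E \<in> cylinders_mod_null t" "D \<in> ?B"
    then obtain B where D: "D = increment t r -` B \<inter> space M" "B \<in> sets borel" by blast
    obtain S A where E: "E \<in> events" "finite S" "S \<subseteq> {0..t}" "\<forall>s. A s \<in> sets borel"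
        "AE \<omega> in M. \<omega> \<in> E \<longleftrightarrow> \<omega> \<in> cylinder S A"
      using \<open>E \<in> cylinders_mod_null t\<close> by (rule cylinders_mod_nullE)
    have D_eq: "D = {\<omega> \<in> space M. increment t r \<omega> \<in> B}" using D by auto
    have ev: "D \<in> events" "cylinder S A \<in> events"
      using D rv E(2-4) by (auto intro!: cylinder_events intro: measurable_sets)
    have "prob E = prob (cylinder S A)"
      using E(5,1) ev(2) by (rule finite_measure_eq_AE)
    moreover have "prob (E \<inter> D) = prob (cylinder S A \<inter> D)"
    proof (rule finite_measure_eq_AE)
      show "AE \<omega> in M. \<omega> \<in> E \<inter> D \<longleftrightarrow> \<omega> \<in> cylinder S A \<inter> D"
        using E(5) by eventually_elim blast
    qed (intro sets.Int ev E(1))+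
    ultimately show "prob (E \<inter> D) = prob E * prob D"
      using cylinder_indep_increment[OF t E(2,3) E(4)[rule_format] D(2)] by (simp add: D_eq)
  qed (rule cylinders_mod_null_events)
  moreover have "Int_stable ?B"
  proof (rule Int_stableI)
    fix D D' assume "D \<in> ?B" "D' \<in> ?B"
    then obtain B B' where "D = increment t r -` B \<inter> space M" "D' = increment t r -` B' \<inter> space M"
        "B \<in> sets borel" "B' \<in> sets borel" by blast
    then have "D \<inter> D' = increment t r -` (B \<inter> B') \<inter> space M" "B \<inter> B' \<in> sets borel" by auto
    then show "D \<inter> D' \<in> ?B" by blast
  qed
  ultimately have "indep_set (sigma_sets (space M) (cylinders_mod_null t)) (sigma_sets (space M) ?B)"
    by (intro indep_set_sigma_sets Int_stable_cylinders_mod_null)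
  moreover have "sigma_sets (space M) {X -` A \<inter> space M | A. A \<in> sets N} \<subseteq> sigma_sets (space M) (cylinders_mod_null t)"
  proof (rule sigma_sets_mono, rule subsetI)
    fix E assume "E \<in> {X -` A \<inter> space M | A. A \<in> sets N}"
    then obtain A where A: "E = X -` A \<inter> space M" "A \<in> sets N" by blast
    then have "X -` A \<inter> space M \<in> sets (\<F> t)" using measurable_sets[OF X] by simp
    then show "E \<in> sigma_sets (space M) (cylinders_mod_null t)"
      unfolding sets_filtration A(1)
      using sigma_sets_subseteq[OF filtration_generators_subset[OF t(1)], of "space M"] by blast
  qed
  moreover have "sigma_sets (space M) {(\<lambda>\<omega>. g (increment t r \<omega>)) -` A \<inter> space M | A. A \<in> sets N'} \<subseteq> sigma_sets (space M) ?B"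
  proof (rule sigma_sets_subseteq, rule subsetI)
    fix E assume "E \<in> {(\<lambda>\<omega>. g (increment t r \<omega>)) -` A \<inter> space M | A. A \<in> sets N'}"
    then obtain A where A: "E = (\<lambda>\<omega>. g (increment t r \<omega>)) -` A \<inter> space M" "A \<in> sets N'" by blast
    have "E = increment t r -` (g -` A) \<inter> space M" "g -` A \<in> sets borel"
      using A measurable_sets[OF g A(2)] by auto
    then show "E \<in> ?B" by blast
  qed
  ultimately have "indep_set (sigma_sets (space M) {X -` A \<inter> space M | A. A \<in> sets N})
      (sigma_sets (space M) {(\<lambda>\<omega>. g (increment t r \<omega>)) -` A \<inter> space M | A. A \<in> sets N'})"
    unfolding indep_sets2_eq by (meson subset_iff)
  then show ?thesis
    unfolding indep_var_eq using measurable_compose[OF rv g] measurable_filtration_M[OF X t(1)] by blast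
qed

end

subsection \<open>Girsanov weights for piecewise constant drifts\<close>
text \<open>The density of \<open>N(m, d)\<close> with respect to \<open>N(0, d)\<close>.\<close>
definition tilt :: "real \<Rightarrow> real \<Rightarrow> real \<Rightarrow> real" where
  "tilt m d x = exp (m / d * x - m\<^sup>2 / (2 * d))"

lemma tilt_pos [simp]: "0 < tilt m d x" and tilt_nonneg [simp]: "0 \<le> tilt m d x"
  by (simp_all add: tilt_def)

lemma tilt_measurable [measurable]: "tilt m d \<in> borel_measurable borel"
  unfolding tilt_def by measurable

lemma normal_density_tilt:
  assumes "0 < d"
  shows "normal_density 0 (sqrt d) x * tilt m d x = normal_density m (sqrt d) x"
proof -
  have "- x\<^sup>2 / (2 * d) + (m / d * x - m\<^sup>2 / (2 * d)) = - (x - m)\<^sup>2 / (2 * d)"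
    using assms by (simp add: field_simps power2_eq_square)
  then show ?thesis
    using assms by (simp add: normal_density_def tilt_def exp_add[symmetric])
qed

text \<open>Completing the square: the factor \<open>exp (- x)\<close> lowers the mean from
  \<open>m\<close> to \<open>m - d\<close>, and the constant left over is the Laplace transform of
  \<open>N(m, d)\<close> at 1.\<close>

lemma tilt_mult_exp_neg:
  assumes "0 < d"
  shows "tilt m d x * exp (- x) = exp (d / 2 - m) * tilt (m - d) d x"
  using assms unfolding tilt_def exp_add[symmetric] by (simp add: field_simps power2_eq_square)

context standard_brownian_motion
begin

lemma nn_integral_increment:
  fixes g :: "real \<Rightarrow> ennreal"
  assumes "0 \<le> s" "s < t" "g \<in> borel_measurable borel"
  shows "(\<integral>\<^sup>+\<omega>. g (increment s t \<omega>) \<partial>M) = (\<integral>\<^sup>+x. normal_density 0 (sqrt (t - s)) x * g x \<partial>lborel)"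
  using distributed_nn_integral[OF normal_increments[OF assms(1,2)], of g] assms(3) by simp

lemma nn_integral_tilt_increment:
  assumes "0 \<le> s" "s < t"
  shows "(\<integral>\<^sup>+\<omega>. tilt m (t - s) (increment s t \<omega>) \<partial>M) = 1"
proof -
  have "(\<integral>\<^sup>+\<omega>. tilt m (t - s) (increment s t \<omega>) \<partial>M)
      = (\<integral>\<^sup>+x. normal_density m (sqrt (t - s)) x \<partial>lborel)"
    using assms by (subst nn_integral_increment) (auto simp: ennreal_mult[symmetric] normal_density_tilt)
  then show ?thesis
    using assms by (simp add: nn_integral_eq_integral)
qed

lemma nn_integral_tilt_exp_neg_increment:
  assumes "0 \<le> s" "s < t"
  shows "(\<integral>\<^sup>+\<omega>. tilt m (t - s) (increment s t \<omega>) * exp (- increment s t \<omega>) \<partial>M)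
    = exp ((t - s) / 2 - m)"
proof -
  have "(\<integral>\<^sup>+\<omega>. tilt m (t - s) (increment s t \<omega>) * exp (- increment s t \<omega>) \<partial>M)
      = (\<integral>\<^sup>+\<omega>. exp ((t - s) / 2 - m) * ennreal (tilt (m - (t - s)) (t - s) (increment s t \<omega>)) \<partial>M)"
    using assms by (intro nn_integral_cong) (simp only: tilt_mult_exp_neg diff_gt_0_iff_gt ennreal_mult tilt_nonneg exp_ge_zero)
  also have "\<dots> = exp ((t - s) / 2 - m)"
    using assms by (subst nn_integral_cmult) (auto simp: nn_integral_tilt_increment intro!: measurable_compose[OF increment_measurable])
  finally show ?thesis .
qed

text \<open>This is the relative entropy of \<open>N(m, d)\<close> with respect to
  \<open>N(0, d)\<close> for \<open>d = t - s\<close>. The log-density is affine in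
  \<open>x\<close>, so its integral under \<open>N(m, d)\<close> involves only the mean.\<close>

lemma integral_tilt_ln_increment:
  assumes "0 \<le> s" "s < t"
  shows "integrable M (\<lambda>\<omega>. tilt m (t - s) (increment s t \<omega>) * ln (tilt m (t - s) (increment s t \<omega>)))"
    and "(\<integral>\<omega>. tilt m (t - s) (increment s t \<omega>) * ln (tilt m (t - s) (increment s t \<omega>)) \<partial>M) = m\<^sup>2 / (2 * (t - s))"
proof -
  let ?d = "t - s"
  let ?g = "\<lambda>x. tilt m ?d x * ln (tilt m ?d x)"
  have d: "0 < ?d" using assms by simp
  have eq: "normal_density 0 (sqrt ?d) x * ?g x
      = m / ?d * (normal_density m (sqrt ?d) x * x) - m\<^sup>2 / (2 * ?d) * normal_density m (sqrt ?d) x" for x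
    unfolding mult.assoc[symmetric] normal_density_tilt[OF d] by (simp add: tilt_def algebra_simps)
  have "integrable lborel (\<lambda>x. normal_density 0 (sqrt ?d) x * ?g x)"
    unfolding eq using d by (intro Bochner_Integration.integrable_diff integrable_mult_right integrable_normal_moment_nz_1) auto
  then show "integrable M (\<lambda>\<omega>. ?g (increment s t \<omega>))"
    using distributed_integrable[OF normal_increments[OF assms], of ?g] by simp
  have "(\<integral>\<omega>. ?g (increment s t \<omega>) \<partial>M) = (\<integral>x. normal_density 0 (sqrt ?d) x * ?g x \<partial>lborel)"
    using distributed_integral[OF normal_increments[OF assms], of ?g] by simp
  also have "\<dots> = m / ?d * m - m\<^sup>2 / (2 * ?d)"
    unfolding eq using d integrable_normal_moment_nz_1[of "sqrt ?d" m]
    by (subst Bochner_Integration.integral_diff) (auto simp: integral_normal_moment_nz_1)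
  also have "\<dots> = m\<^sup>2 / (2 * ?d)"
  proof -
    have "m / d * m - m\<^sup>2 / (2 * d) = m\<^sup>2 / (2 * d)" if "0 < d" for d :: real
      using that by (simp add: field_simps power2_eq_square)
    then show ?thesis using d .
  qed
  finally show "(\<integral>\<omega>. ?g (increment s t \<omega>) \<partial>M) = m\<^sup>2 / (2 * ?d)" .
qed

lemma nn_integral_mult_increment:
  fixes X :: "'a \<Rightarrow> ennreal" and g :: "real \<Rightarrow> ennreal"
  assumes "0 \<le> s" "s < t" "X \<in> borel_measurable (\<F> s)" and g: "g \<in> borel_measurable borel"
  shows "(\<integral>\<^sup>+\<omega>. X \<omega> * g (increment s t \<omega>) \<partial>M) = (\<integral>\<^sup>+\<omega>. X \<omega> \<partial>M) * (\<integral>\<^sup>+\<omega>. g (increment s t \<omega>) \<partial>M)"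
proof -
  let ?Y = "case_bool X (g \<circ> increment s t)"
  have "indep_var borel X borel (g \<circ> increment s t)"
    using indep_var_increment[OF assms] by (simp add: comp_def)
  then have "indep_vars (case_bool borel borel) ?Y UNIV"
    by (simp add: indep_var_def)
  also have "case_bool borel borel = (\<lambda>_. borel :: ennreal measure)"
    by (simp add: fun_eq_iff split: bool.split)
  finally have "(\<integral>\<^sup>+\<omega>. (\<Prod>i\<in>UNIV. ?Y i \<omega>) \<partial>M) = (\<Prod>i\<in>UNIV. \<integral>\<^sup>+\<omega>. ?Y i \<omega> \<partial>M)"
    by (intro indep_vars_nn_integral) auto
  then show ?thesis by (simp add: UNIV_bool mult.commute comp_def)
qed

text \<open>On an increasing grid starting at 0 this is the density of a measure under which the
  first \<open>n\<close> grid increments of \<open>W\<close> stay independent Gaussian with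
  unchanged variances but mean \<open>m\<close> each. The drift on a grid interval is thus
  \<open>m\<close> divided by its length.\<close>

definition weight :: "(nat \<Rightarrow> real) \<Rightarrow> real \<Rightarrow> nat \<Rightarrow> 'a \<Rightarrow> real" where
  "weight \<tau> m n \<omega> = (\<Prod>i<n. tilt m (\<tau> (Suc i) - \<tau> i) (increment (\<tau> i) (\<tau> (Suc i)) \<omega>))"

lemma weight_pos [simp]: "0 < weight \<tau> m n \<omega>" and weight_nonneg [simp]: "0 \<le> weight \<tau> m n \<omega>"
  by (simp_all add: weight_def prod_pos prod_nonneg)

lemma weight_0 [simp]: "weight \<tau> m 0 \<omega> = 1"
  by (simp add: weight_def)

lemma weight_Suc:
  "weight \<tau> m (Suc n) \<omega> = weight \<tau> m n \<omega> * tilt m (\<tau> (Suc n) - \<tau> n) (increment (\<tau> n) (\<tau> (Suc n)) \<omega>)"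
  by (simp add: weight_def)

context
  fixes \<tau> :: "nat \<Rightarrow> real" and m :: real
  assumes \<tau>: "strict_mono \<tau>" "\<tau> 0 = 0"
begin

lemma times_nonneg: "0 \<le> \<tau> i"
  using strict_mono_less_eq[OF \<tau>(1), of 0 i] \<tau>(2) by simp

lemma times_less_Suc: "\<tau> i < \<tau> (Suc i)"
  using \<tau>(1) by (simp add: strict_mono_Suc_iff)

lemma weight_adapted: "weight \<tau> m n \<in> borel_measurable (\<F> (\<tau> n))"
  unfolding weight_def
proof (intro borel_measurable_prod)
  fix i assume "i \<in> {..<n}"
  then have "\<tau> (Suc i) \<le> \<tau> n" "\<tau> i \<le> \<tau> n"
    using strict_mono_less_eq[OF \<tau>(1)] by auto
  then have [measurable]: "W (\<tau> (Suc i)) \<in> borel_measurable (\<F> (\<tau> n))" "W (\<tau> i) \<in> borel_measurable (\<F> (\<tau> n))"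
    using times_nonneg by (auto intro: W_adapted)
  show "(\<lambda>\<omega>. tilt m (\<tau> (Suc i) - \<tau> i) (increment (\<tau> i) (\<tau> (Suc i)) \<omega>)) \<in> borel_measurable (\<F> (\<tau> n))"
    by measurable
qed

lemma weight_measurable [measurable]: "weight \<tau> m n \<in> borel_measurable M"
  using weight_adapted times_nonneg by (rule measurable_filtration_M)

text \<open>One step of the martingale property: the new factor is independent of
  \<open>\<F> (\<tau> n)\<close> and has mean 1.\<close>

lemma nn_integral_weight_Suc:
  fixes X :: "'a \<Rightarrow> ennreal"
  assumes [measurable]: "X \<in> borel_measurable (\<F> (\<tau> n))"
  shows "(\<integral>\<^sup>+\<omega>. X \<omega> * weight \<tau> m (Suc n) \<omega> \<partial>M) = (\<integral>\<^sup>+\<omega>. X \<omega> * weight \<tau> m n \<omega> \<partial>M)"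
proof -
  note weight_adapted[measurable]
  let ?h = "\<lambda>x. ennreal (tilt m (\<tau> (Suc n) - \<tau> n) x)"
  have "(\<integral>\<^sup>+\<omega>. X \<omega> * weight \<tau> m (Suc n) \<omega> \<partial>M)
      = (\<integral>\<^sup>+\<omega>. (X \<omega> * weight \<tau> m n \<omega>) * ?h (increment (\<tau> n) (\<tau> (Suc n)) \<omega>) \<partial>M)"
    by (simp add: weight_Suc ennreal_mult mult.assoc)
  also have "\<dots> = (\<integral>\<^sup>+\<omega>. X \<omega> * weight \<tau> m n \<omega> \<partial>M)"
    using times_nonneg times_less_Suc by (subst nn_integral_mult_increment) (auto simp: nn_integral_tilt_increment)
  finally show ?thesis .
qed

lemma nn_integral_weight_martingale:
  fixes X :: "'a \<Rightarrow> ennreal"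
  assumes X: "X \<in> borel_measurable (\<F> (\<tau> j))" and "j \<le> n"
  shows "(\<integral>\<^sup>+\<omega>. X \<omega> * weight \<tau> m n \<omega> \<partial>M) = (\<integral>\<^sup>+\<omega>. X \<omega> * weight \<tau> m j \<omega> \<partial>M)"
  using \<open>j \<le> n\<close>
proof (induction n rule: dec_induct)
  case (step n)
  then have "X \<in> borel_measurable (\<F> (\<tau> n))"
    using strict_mono_less_eq[OF \<tau>(1)] by (intro measurable_filtration_mono[OF X]) simp
  with step.IH show ?case by (simp add: nn_integral_weight_Suc)
qed simp

lemma nn_integral_weight: "(\<integral>\<^sup>+\<omega>. weight \<tau> m n \<omega> \<partial>M) = 1"
  using nn_integral_weight_martingale[of "\<lambda>_. 1" 0 n] by (simp add: emeasure_space_1)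

lemma integral_weight: "integrable M (weight \<tau> m n)" "(\<integral>\<omega>. weight \<tau> m n \<omega> \<partial>M) = 1"
proof -
  show int: "integrable M (weight \<tau> m n)"
    by (rule integrableI_nonneg) (auto simp: nn_integral_weight)
  show "(\<integral>\<omega>. weight \<tau> m n \<omega> \<partial>M) = 1"
    using nn_integral_weight[of n] by (subst integral_eq_nn_integral) auto
qed

text \<open>Chain rule for relative entropy. The logarithm of the product splits into two terms; in
  each, the factor without logarithm is independent of the rest and has mean 1, so the entropies of
  the single steps add up.\<close>

lemma entropy_weight:
  "integrable M (\<lambda>\<omega>. weight \<tau> m n \<omega> * ln (weight \<tau> m n \<omega>)) \<and>
   (\<integral>\<omega>. weight \<tau> m n \<omega> * ln (weight \<tau> m n \<omega>) \<partial>M) = (\<Sum>i<n. m\<^sup>2 / (2 * (\<tau> (Suc i) - \<tau> i)))"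
proof (induction n)
  case (Suc n)
  note weight_adapted[measurable]
  let ?t = "tilt m (\<tau> (Suc n) - \<tau> n)" and ?D = "increment (\<tau> n) (\<tau> (Suc n))"
  let ?w = "weight \<tau> m n"
  note step = times_nonneg[of n] times_less_Suc[of n]
  have [measurable]: "?D \<in> borel_measurable M"
    using times_nonneg by (intro increment_measurable)
  have ind1: "indep_var borel (\<lambda>\<omega>. ?w \<omega> * ln (?w \<omega>)) borel (\<lambda>\<omega>. ?t (?D \<omega>))"
    using step by (intro indep_var_increment) measurable
  have ind2: "indep_var borel ?w borel (\<lambda>\<omega>. ?t (?D \<omega>) * ln (?t (?D \<omega>)))"
    using step by (intro indep_var_increment[where g="\<lambda>x. ?t x * ln (?t x)"]) measurable
  have t_int: "integrable M (\<lambda>\<omega>. ?t (?D \<omega>))"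
    by (rule integrableI_nonneg) (auto simp: nn_integral_tilt_increment[OF step])
  have t_1: "(\<integral>\<omega>. ?t (?D \<omega>) \<partial>M) = 1"
    by (subst integral_eq_nn_integral) (auto simp: nn_integral_tilt_increment[OF step])
  note tl = integral_tilt_ln_increment[OF step, of m]
  have eq: "weight \<tau> m (Suc n) \<omega> * ln (weight \<tau> m (Suc n) \<omega>)
      = (?w \<omega> * ln (?w \<omega>)) * ?t (?D \<omega>) + ?w \<omega> * (?t (?D \<omega>) * ln (?t (?D \<omega>)))" for \<omega>
    by (simp add: weight_Suc ln_mult algebra_simps)
  have i1: "integrable M (\<lambda>\<omega>. (?w \<omega> * ln (?w \<omega>)) * ?t (?D \<omega>))"
    and i2: "integrable M (\<lambda>\<omega>. ?w \<omega> * (?t (?D \<omega>) * ln (?t (?D \<omega>))))"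
    using Suc indep_var_integrable[OF ind1 _ t_int] indep_var_integrable[OF ind2 integral_weight(1) tl(1)] by auto
  have "(\<integral>\<omega>. (?w \<omega> * ln (?w \<omega>)) * ?t (?D \<omega>) \<partial>M) = (\<integral>\<omega>. ?w \<omega> * ln (?w \<omega>) \<partial>M)"
    using Suc indep_var_lebesgue_integral[OF ind1 _ t_int] t_1 by simp
  moreover have "(\<integral>\<omega>. ?w \<omega> * (?t (?D \<omega>) * ln (?t (?D \<omega>))) \<partial>M) = m\<^sup>2 / (2 * (\<tau> (Suc n) - \<tau> n))"
    using indep_var_lebesgue_integral[OF ind2 integral_weight(1) tl(1)] integral_weight(2) tl(2) by simp
  ultimately show ?case
    unfolding eq using Suc i1 i2 by (simp add: Bochner_Integration.integral_add)
qed simp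

text \<open>Under the weighted measure \<open>W (\<tau> n)\<close> has mean \<open>n * m\<close> and
  variance \<open>\<tau> n\<close>; this is its Laplace transform at 1, prepared for a Chernoff
  bound.\<close>

lemma nn_integral_weight_exp_neg:
  "(\<integral>\<^sup>+\<omega>. weight \<tau> m n \<omega> * exp (- W (\<tau> n) \<omega>) \<partial>M) = exp (\<tau> n / 2 - n * m)"
proof (induction n)
  case 0
  have "(\<integral>\<^sup>+\<omega>. exp (- W 0 \<omega>) \<partial>M) = (\<integral>\<^sup>+\<omega>. 1 \<partial>M)"
    by (rule nn_integral_cong_AE) (use start_zero in eventually_elim, simp)
  then show ?case by (simp add: \<tau>(2) emeasure_space_1)
next
  case (Suc n)
  note weight_adapted[measurable]
  have [measurable]: "W (\<tau> n) \<in> borel_measurable (\<F> (\<tau> n))" using times_nonneg by (intro W_adapted) auto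
  let ?t = "tilt m (\<tau> (Suc n) - \<tau> n)" and ?D = "increment (\<tau> n) (\<tau> (Suc n))"
  have "(\<integral>\<^sup>+\<omega>. weight \<tau> m (Suc n) \<omega> * exp (- W (\<tau> (Suc n)) \<omega>) \<partial>M)
      = (\<integral>\<^sup>+\<omega>. ennreal (weight \<tau> m n \<omega> * exp (- W (\<tau> n) \<omega>)) * ennreal (?t (?D \<omega>) * exp (- ?D \<omega>)) \<partial>M)"
    by (intro nn_integral_cong) (simp add: weight_Suc ennreal_mult[symmetric] mult_exp_exp[symmetric] exp_diff exp_minus field_simps)
  also have "\<dots> = ennreal (exp (\<tau> n / 2 - n * m)) * ennreal (exp ((\<tau> (Suc n) - \<tau> n) / 2 - m))"
    using times_nonneg times_less_Suc Suc
    by (subst nn_integral_mult_increment[where g="\<lambda>x. ennreal (?t x * exp (- x))"])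
       (auto simp: nn_integral_tilt_exp_neg_increment simp del: minus_diff_eq)
  also have "\<dots> = exp (\<tau> (Suc n) / 2 - Suc n * m)"
    by (simp add: ennreal_mult[symmetric] mult_exp_exp field_simps)
  finally show ?case .
qed

lemma nn_integral_weight_exp_neg_later:
  assumes "\<tau> n < T"
  shows "(\<integral>\<^sup>+\<omega>. weight \<tau> m n \<omega> * exp (- W T \<omega>) \<partial>M) = exp (T / 2 - n * m)"
proof -
  note weight_adapted[measurable]
  have [measurable]: "W (\<tau> n) \<in> borel_measurable (\<F> (\<tau> n))" using times_nonneg by (intro W_adapted) auto
  have "(\<integral>\<^sup>+\<omega>. weight \<tau> m n \<omega> * exp (- W T \<omega>) \<partial>M)
      = (\<integral>\<^sup>+\<omega>. ennreal (weight \<tau> m n \<omega> * exp (- W (\<tau> n) \<omega>)) * ennreal (exp (- increment (\<tau> n) T \<omega>)) \<partial>M)"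
    by (intro nn_integral_cong) (simp add: ennreal_mult[symmetric] exp_diff exp_minus field_simps)
  \<comment> \<open>After \<open>\<tau> n\<close> the weight adds no drift, so the last increment is
    handled by the tilt with mean 0, which is identically 1.\<close>
  also have "\<dots> = ennreal (exp (\<tau> n / 2 - n * m)) * ennreal (exp ((T - \<tau> n) / 2))"
    using times_nonneg assms nn_integral_tilt_exp_neg_increment[of "\<tau> n" T 0]
    by (subst nn_integral_mult_increment[where g="\<lambda>x. ennreal (exp (- x))"])
       (auto simp: nn_integral_weight_exp_neg tilt_def simp del: minus_diff_eq)
  also have "\<dots> = exp (T / 2 - n * m)"
    by (simp add: ennreal_mult[symmetric] mult_exp_exp field_simps)
  finally show ?thesis .
qed

end
end

subsection \<open>Duality bound for the cost\<close>
text \<open>Fenchel-Young inequality for the exponential, obtained from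
  \<open>1 + y \<le> exp y\<close> at \<open>y = a - ln z\<close>. The case \<open>a = 0\<close>
  states that the entropy term is nonnegative.\<close>

lemma mult_le_exp_plus_entropy:
  fixes a z :: real
  assumes "0 < z"
  shows "a * z \<le> (exp a - 1) + (z * ln z - z + 1)"
proof -
  have "z * (1 + (a - ln z)) \<le> z * exp (a - ln z)"
    using assms exp_ge_add_one_self[of "a - ln z"] by (intro mult_left_mono) auto
  also have "\<dots> = exp a" using assms by (simp add: exp_diff)
  finally show ?thesis by (simp add: algebra_simps)
qed

text \<open>Each step is half of the remaining time, so shifting every increment by \<open>m\<close> costs entropy
  \<open>m\<^sup>2\<close> per step after integration over the remaining time, whatever the step: \<open>n\<close> steps shift
  \<open>W\<close> by \<open>n m\<close> at total price \<open>n m\<^sup>2\<close>.\<close>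
definition dyadic :: "real \<Rightarrow> nat \<Rightarrow> real" where
  "dyadic T i = T * (1 - (1 / 2) ^ i)"

lemma dyadic_0 [simp]: "dyadic T 0 = 0"
  by (simp add: dyadic_def)

lemma dyadic_less: "0 < T \<Longrightarrow> dyadic T i < T"
  by (simp add: dyadic_def)

lemma dyadic_gap: "T - dyadic T i = 2 * (dyadic T (Suc i) - dyadic T i)"
  by (simp add: dyadic_def algebra_simps)

lemma strict_mono_dyadic: "0 < T \<Longrightarrow> strict_mono (dyadic T)"
  by (simp add: strict_mono_Suc_iff dyadic_def)

text \<open>Selects the factors of the weight whose intervals begin before \<open>t\<close>: there
  are \<open>j\<close> of them, and unless the grid is exhausted the time \<open>\<tau> j\<close> is
  no earlier than \<open>t\<close>.\<close>

lemma initial_segment_below: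
  fixes \<tau> :: "nat \<Rightarrow> real"
  assumes "strict_mono \<tau>"
  obtains j where "j \<le> n" "{i. i < n \<and> \<tau> i < t} = {..<j}" "j = n \<or> t \<le> \<tau> j"
proof (cases "\<exists>j<n. t \<le> \<tau> j")
  case True
  then obtain k where k: "k < n" "t \<le> \<tau> k" by blast
  define j where "j = (LEAST j. t \<le> \<tau> j)"
  have j: "t \<le> \<tau> j" unfolding j_def using k(2) by (rule LeastI)
  have "j \<le> k" unfolding j_def using k(2) by (rule Least_le)
  then have "j < n" using k(1) by simp
  have iff: "\<tau> i < t \<longleftrightarrow> i < j" for i
  proof
    show "\<tau> i < t" if "i < j" using not_less_Least[of i "\<lambda>j. t \<le> \<tau> j"] that by (simp add: j_def not_le)
    show "i < j" if "\<tau> i < t"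
      using less_le_trans[OF that j] strict_mono_less[OF assms, of i j] by simp
  qed
  have "{i. i < n \<and> \<tau> i < t} = {..<j}"
    unfolding iff using \<open>j < n\<close> by (intro set_eqI) auto
  then show thesis
    by (rule that[of j, rotated]) (use j \<open>j < n\<close> in simp_all)
next
  case False
  then have "{i. i < n \<and> \<tau> i < t} = {..<n}" by (auto simp: not_le)
  then show thesis by (intro that[of n] order_refl disjI1 refl)
qed

context standard_brownian_motion
begin

text \<open>The weight at the first grid time after \<open>t\<close> is not \<open>\<F> t\<close>-measurable, but it is still a
  conditional expectation of the last weight, and that is all the duality needs.\<close>
lemma duality_at_time:
  fixes v :: "'a \<Rightarrow> real"
  assumes \<tau>: "strict_mono \<tau>" "\<tau> 0 = 0" and t: "0 \<le> t"
    and v: "v \<in> borel_measurable (\<F> t)" "\<And>\<omega>. 0 \<le> v \<omega>" and K: "0 < K"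
  shows "(\<integral>\<^sup>+\<omega>. ennreal (K * v \<omega>) * weight \<tau> m n \<omega> \<partial>M)
    \<le> (\<integral>\<^sup>+\<omega>. ennreal (exp (v \<omega>) - 1) \<partial>M)
      + ennreal ((K * ln K - K + 1) + K * (\<Sum>i<n. if \<tau> i < t then m\<^sup>2 / (2 * (\<tau> (Suc i) - \<tau> i)) else 0))"
proof -
  obtain j where j: "j \<le> n" "{i. i < n \<and> \<tau> i < t} = {..<j}" "j = n \<or> t \<le> \<tau> j"
    using initial_segment_below[OF \<tau>(1)] by blast
  let ?h = "\<lambda>i. m\<^sup>2 / (2 * (\<tau> (Suc i) - \<tau> i))" and ?w = "weight \<tau> m j"
  have sum_eq: "(\<Sum>i<n. if \<tau> i < t then ?h i else 0) = (\<Sum>i<j. ?h i)"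
    unfolding j(2)[symmetric] by (subst sum.inter_filter[symmetric]) (auto intro!: sum.cong)
  have [measurable]: "v \<in> borel_measurable M" using v(1) t by (rule measurable_filtration_M)
  note weight_measurable[OF \<tau>, measurable]
  \<comment> \<open>If \<open>t \<le> \<tau> j\<close>, then \<open>v\<close> is known at time
    \<open>\<tau> j\<close> and the martingale property removes the factors after \<open>j\<close>;
    if \<open>j = n\<close> there are none to remove.\<close>
  have swap: "(\<integral>\<^sup>+\<omega>. ennreal (K * v \<omega>) * weight \<tau> m n \<omega> \<partial>M) = (\<integral>\<^sup>+\<omega>. ennreal (K * v \<omega>) * ?w \<omega> \<partial>M)"
    using j(3)
  proof
    assume "t \<le> \<tau> j"
    with v(1) have [measurable]: "v \<in> borel_measurable (\<F> (\<tau> j))" by (rule measurable_filtration_mono)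
    show ?thesis by (rule nn_integral_weight_martingale[OF \<tau> _ j(1)]) simp
  qed simp
  \<comment> \<open>The entropy term of the Young inequality at
    \<open>z = K * weight \<tau> m j\<close>. Its integral needs only the mass 1 and the entropy of
    that weight.\<close>
  define \<phi> where "\<phi> \<omega> = K * ?w \<omega> * ln (K * ?w \<omega>) - K * ?w \<omega> + 1" for \<omega>
  have \<phi>_nonneg: "0 \<le> \<phi> \<omega>" for \<omega>
    using mult_le_exp_plus_entropy[of "K * ?w \<omega>" 0] K by (simp add: \<phi>_def)
  have \<phi>_eq: "\<phi> \<omega> = (K * ln K - K) * ?w \<omega> + K * (?w \<omega> * ln (?w \<omega>)) + 1" for \<omega>
    using K by (simp add: \<phi>_def ln_mult algebra_simps)
  note ent = entropy_weight[OF \<tau>, of m j] and w = integral_weight[OF \<tau>, of m j]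
  have \<phi>_int: "integrable M \<phi>"
    unfolding \<phi>_eq using ent w by auto
  have \<phi>_integral: "(\<integral>\<omega>. \<phi> \<omega> \<partial>M) = (K * ln K - K + 1) + K * (\<Sum>i<j. ?h i)"
    unfolding \<phi>_eq using ent w by (simp add: prob_space)
  have "(\<integral>\<^sup>+\<omega>. ennreal (K * v \<omega>) * ?w \<omega> \<partial>M) \<le> (\<integral>\<^sup>+\<omega>. ennreal (exp (v \<omega>) - 1) + ennreal (\<phi> \<omega>) \<partial>M)"
  proof (rule nn_integral_mono)
    fix \<omega>
    have "K * v \<omega> * ?w \<omega> \<le> (exp (v \<omega>) - 1) + \<phi> \<omega>"
      using mult_le_exp_plus_entropy[of "K * ?w \<omega>" "v \<omega>"] K by (simp add: \<phi>_def algebra_simps)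
    then show "ennreal (K * v \<omega>) * ?w \<omega> \<le> ennreal (exp (v \<omega>) - 1) + ennreal (\<phi> \<omega>)"
      using v(2) K \<phi>_nonneg by (simp add: ennreal_mult[symmetric] ennreal_plus[symmetric] ennreal_leI del: ennreal_plus)
  qed
  also have "\<dots> = (\<integral>\<^sup>+\<omega>. ennreal (exp (v \<omega>) - 1) \<partial>M) + (\<integral>\<^sup>+\<omega>. ennreal (\<phi> \<omega>) \<partial>M)"
    using \<phi>_int by (intro nn_integral_add) auto
  also have "(\<integral>\<^sup>+\<omega>. ennreal (\<phi> \<omega>) \<partial>M) = ennreal (\<integral>\<omega>. \<phi> \<omega> \<partial>M)"
    using \<phi>_int \<phi>_nonneg by (intro nn_integral_eq_integral) auto
  finally show ?thesis unfolding swap sum_eq \<phi>_integral .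
qed

text \<open>Chernoff bound: where \<open>W T \<le> c\<close>, the indicator is dominated by
  \<open>exp (c - W T)\<close>. If the real number on the left is negative, \<open>ennreal\<close>
  truncates it to 0.\<close>

lemma weight_mass_above:
  assumes \<tau>: "strict_mono \<tau>" "\<tau> 0 = 0" and "\<tau> n < T"
  shows "ennreal (1 - exp (c + T / 2 - n * m))
    \<le> (\<integral>\<^sup>+\<omega>. weight \<tau> m n \<omega> * indicator {\<omega>. c < W T \<omega>} \<omega> \<partial>M)" (is "_ \<le> ?A")
proof -
  note weight_measurable[OF \<tau>, measurable]
  have "0 \<le> T" using times_nonneg[OF \<tau>, of n] assms(3) by simp
  then have [measurable]: "W T \<in> borel_measurable M" by (rule measurable_W)
  have "1 = (\<integral>\<^sup>+\<omega>. weight \<tau> m n \<omega> \<partial>M)" by (simp add: nn_integral_weight[OF \<tau>])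
  also have "\<dots> \<le> (\<integral>\<^sup>+\<omega>. ennreal (weight \<tau> m n \<omega> * indicator {\<omega>. c < W T \<omega>} \<omega>)
      + ennreal (exp c) * ennreal (weight \<tau> m n \<omega> * exp (- W T \<omega>)) \<partial>M)"
  proof (rule nn_integral_mono)
    fix \<omega>
    show "ennreal (weight \<tau> m n \<omega>) \<le> ennreal (weight \<tau> m n \<omega> * indicator {\<omega>. c < W T \<omega>} \<omega>)
      + ennreal (exp c) * ennreal (weight \<tau> m n \<omega> * exp (- W T \<omega>))"
    proof (cases "c < W T \<omega>")
      case False
      then have "weight \<tau> m n \<omega> * 1 \<le> weight \<tau> m n \<omega> * exp (c - W T \<omega>)"
        by (intro mult_left_mono) auto
      then show ?thesis
        using False by (simp add: ennreal_mult[symmetric] ennreal_leI exp_diff exp_minus field_simps)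
    qed simp
  qed
  also have "\<dots> = ?A + ennreal (exp c) * ennreal (exp (T / 2 - n * m))"
    using nn_integral_weight_exp_neg_later[OF \<tau> assms(3), of m]
    by (subst nn_integral_add) (auto simp: nn_integral_cmult)
  also have "ennreal (exp c) * ennreal (exp (T / 2 - n * m)) = exp (c + T / 2 - n * m)"
    by (simp add: ennreal_mult[symmetric] mult_exp_exp field_simps)
  finally have "1 \<le> ?A + ennreal (exp (c + T / 2 - n * m))" .
  then have "1 - ennreal (exp (c + T / 2 - n * m)) \<le> ?A"
    by (simp add: ennreal_minus_le_iff add.commute)
  then show ?thesis
    by (simp add: ennreal_minus[symmetric])
qed

end

section \<open>Integration over the time interval\<close>

lemma finite_measure_interval: "finite_measure (restrict_space lborel {0..T::real})"
  by (intro finite_measureI) (simp add: emeasure_restrict_space space_restrict_space emeasure_lborel_Icc_eq)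

text \<open>Step \<open>i\<close> contributes the constant \<open>m^2 / (T - dyadic T i)\<close> on
  an interval of length exactly \<open>T - dyadic T i\<close>, hence \<open>m^2\<close> for every
  \<open>i\<close>.\<close>

lemma nn_integral_dyadic_steps:
  assumes "0 < T" "0 \<le> A" "0 \<le> K"
  shows "(\<integral>\<^sup>+t. ennreal (A + K * (\<Sum>i<n. if dyadic T i < t then m\<^sup>2 / (2 * (dyadic T (Suc i) - dyadic T i)) else 0))
      \<partial>restrict_space lborel {0..T}) = ennreal (T * A + K * (n * m\<^sup>2))"
proof -
  let ?L = "restrict_space lborel {0..T}"
  define h where "h i = m\<^sup>2 / (2 * (dyadic T (Suc i) - dyadic T i))" for i
  have gap: "0 < T - dyadic T i" for i using dyadic_less[OF assms(1), of i] by simp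
  then have h_eq: "h i = m\<^sup>2 / (T - dyadic T i)" for i by (simp add: h_def dyadic_gap)
  have h_nonneg: "0 \<le> h i" for i unfolding h_eq using gap[of i] by simp
  have [measurable]: "{t \<in> space ?L. d < t} \<in> sets ?L" for d
    by (auto simp: sets_restrict_space_iff space_restrict_space intro!: sets.Int)
  have emeasure_L: "emeasure ?L {0..T} = T"
    using assms by (simp add: emeasure_restrict_space)
  have step: "(\<integral>\<^sup>+t. ennreal (K * (if dyadic T i < t then h i else 0)) \<partial>?L) = ennreal (K * m\<^sup>2)" for i
  proof -
    have "0 \<le> dyadic T i" using assms by (simp add: dyadic_def power_le_one)
    then have "(\<integral>\<^sup>+t. ennreal (K * (if dyadic T i < t then h i else 0)) \<partial>?L)
        = (\<integral>\<^sup>+t. ennreal (K * h i) * indicator {dyadic T i<..T} t \<partial>lborel)"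
      by (subst nn_integral_restrict_space) (auto intro!: nn_integral_cong simp: indicator_def)
    also have "\<dots> = ennreal (K * h i) * ennreal (T - dyadic T i)"
      using gap[of i] by (subst nn_integral_cmult_indicator) auto
    also have "\<dots> = ennreal (K * m\<^sup>2)"
      using assms gap[of i] h_nonneg[of i] by (subst ennreal_mult[symmetric]) (auto simp: h_eq)
    finally show ?thesis .
  qed
  have "(\<integral>\<^sup>+t. ennreal (A + K * (\<Sum>i<n. if dyadic T i < t then h i else 0)) \<partial>?L)
      = (\<integral>\<^sup>+t. ennreal A + (\<Sum>i<n. ennreal (K * (if dyadic T i < t then h i else 0))) \<partial>?L)"
    using assms h_nonneg
    by (intro nn_integral_cong) (subst sum_ennreal, auto simp: sum_distrib_left intro!: sum_nonneg ennreal_plus)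
  also have "\<dots> = ennreal A * T + (\<Sum>i<n. ennreal (K * m\<^sup>2))"
    by (subst nn_integral_add, simp, simp, subst nn_integral_sum) (simp_all add: step emeasure_L)
  also have "\<dots> = ennreal (T * A + K * (n * m\<^sup>2))"
    using assms by (subst sum_ennreal) (auto simp: ennreal_mult[symmetric] ennreal_plus[symmetric] mult_ac simp del: ennreal_plus)
  finally show ?thesis unfolding h_def .
qed

abbreviation (input) time_interval :: "real \<Rightarrow> real measure" where
  "time_interval T \<equiv> restrict_space lborel {0..T}"

lemma expected_cost_interval:
  "expected_cost M lam T u = (\<integral>\<^sup>+\<omega>. (\<integral>\<^sup>+t. ennreal (exp (lam * \<bar>u t \<omega>\<bar>) - 1) \<partial>time_interval T) \<partial>M)"
  unfolding expected_cost_def by (simp add: nn_integral_restrict_space)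

section \<open>Strict convexity of the running cost\<close>

lemma strict_convexity_exp_abs:
  fixes lam a b :: real
  assumes lam: "0 < lam" and b: "0 \<le> b"
    and eq: "exp (lam * \<bar>(a + b) / 2\<bar>) \<ge> (exp (lam * \<bar>a\<bar>) + exp (lam * b)) / 2"
  shows "a = b"
proof -
  define p q where "p = exp (lam * \<bar>a\<bar> / 2)" and "q = exp (lam * b / 2)"
  have pq: "exp (lam * \<bar>a\<bar>) = p\<^sup>2" "exp (lam * b) = q\<^sup>2" "0 < p" "0 < q"
    by (simp_all add: p_def q_def exp_double[symmetric])
  have "lam * \<bar>a + b\<bar> \<le> lam * (\<bar>a\<bar> + b)"
    using lam b by (intro mult_left_mono) auto
  then have "exp (lam * \<bar>(a + b) / 2\<bar>) \<le> exp (lam * \<bar>a\<bar> / 2 + lam * b / 2)"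
    by (simp add: field_simps)
  also have "\<dots> = p * q" by (simp add: p_def q_def exp_add)
  finally have upper: "exp (lam * \<bar>(a + b) / 2\<bar>) \<le> p * q" .
  \<comment> \<open>The hypothesis reverses the inequality of arithmetic and geometric means for
    \<open>p^2\<close> and \<open>q^2\<close>, which forces equality.\<close>
  then have "(p - q)\<^sup>2 \<le> 0"
    using eq pq by (simp add: power2_eq_square algebra_simps)
  then have "p = q" by simp
  then have abs_a: "\<bar>a\<bar> = b" using lam by (simp add: p_def q_def)
  \<comment> \<open>Knowing \<open>\<bar>a\<bar> = b\<close>, it remains to exclude
    \<open>a = - b\<close> with \<open>b > 0\<close>, where the midpoint is 0 and the hypothesis
    fails.\<close>
  then have "exp (lam * \<bar>(a + b) / 2\<bar>) \<ge> exp (lam * b)"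
    using eq by simp
  then have "b \<le> \<bar>(a + b) / 2\<bar>" using lam by simp
  then show ?thesis using abs_a by (cases "a \<ge> 0") auto
qed

text \<open>A violation would satisfy the reversed inequality, forcing \<open>a = b\<close>, where
  both sides coincide.\<close>

lemma midpoint_exp_abs:
  fixes lam a b :: real
  assumes "0 < lam" "0 \<le> b"
  shows "exp (lam * \<bar>(a + b) / 2\<bar>) \<le> (exp (lam * \<bar>a\<bar>) + exp (lam * b)) / 2"
proof (rule ccontr)
  assume *: "\<not> ?thesis"
  then have "a = b" using strict_convexity_exp_abs[OF assms, of a] by simp
  with * assms show False by simp
qed

section \<open>Lower bound for the cost of a control\<close>

context standard_brownian_motion
begin

context
  fixes T :: real
  assumes T: "0 < T"
begin

lemma progressively_measurable_section:
  assumes "progressively_measurable \<F> T u" "t \<in> {0..T}"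
  shows "u t \<in> borel_measurable (\<F> t)"
proof -
  have "t \<in> space (restrict_space borel {0..t})" using assms(2) by (simp add: space_restrict_space)
  moreover have "(\<lambda>(s, \<omega>). u s \<omega>) \<in> borel_measurable (restrict_space borel {0..t} \<Otimes>\<^sub>M \<F> t)"
    using assms unfolding progressively_measurable_def by blast
  ultimately show ?thesis
    using measurable_compose[OF measurable_Pair1'] by fastforce
qed

text \<open>\<open>\<F> T\<close> is coarser than \<open>M\<close>, so measurability at the final
  time lifts to the product with \<open>M\<close>, as the Fubini arguments require.\<close>

lemma progressively_measurable_joint:
  assumes "progressively_measurable \<F> T u"
  shows "(\<lambda>(t, \<omega>). u t \<omega>) \<in> borel_measurable (time_interval T \<Otimes>\<^sub>M M)"
proof -
  have "(\<lambda>(s, \<omega>). u s \<omega>) \<in> borel_measurable (restrict_space borel {0..T} \<Otimes>\<^sub>M \<F> T)"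
    using assms T unfolding progressively_measurable_def by auto
  moreover have "(\<lambda>p. p) \<in> time_interval T \<Otimes>\<^sub>M M \<rightarrow>\<^sub>M restrict_space borel {0..T} \<Otimes>\<^sub>M \<F> T"
  proof (rule measurable_pair)
    have "(\<lambda>t. t) \<in> time_interval T \<rightarrow>\<^sub>M restrict_space borel {0..T}"
      by (intro measurable_ident_sets sets_restrict_space_cong) simp
    from measurable_compose[OF measurable_fst this]
    show "fst \<circ> (\<lambda>p. p) \<in> time_interval T \<Otimes>\<^sub>M M \<rightarrow>\<^sub>M restrict_space borel {0..T}" by (simp add: comp_def)
    have "(\<lambda>\<omega>. \<omega>) \<in> M \<rightarrow>\<^sub>M \<F> T"
      using T by (intro measurable_filtration_M[where t=T]) auto
    from measurable_compose[OF measurable_snd this]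
    show "snd \<circ> (\<lambda>p. p) \<in> time_interval T \<Otimes>\<^sub>M M \<rightarrow>\<^sub>M \<F> T" by (simp add: comp_def)
  qed
  ultimately show ?thesis
    using measurable_compose by fastforce
qed

lemma pair_sigma_finite_interval: "pair_sigma_finite (time_interval T) M"
proof -
  interpret L: finite_measure "time_interval T" by (rule finite_measure_interval)
  show ?thesis by unfold_locales
qed

text \<open>The weighted measure puts mass close to 1 on \<open>W T > c\<close>, where the control
  has total variation at least \<open>g\<close>. Its weighted variation is therefore large, and the
  duality bound at each time, integrated over time, turns this into cost.\<close>

lemma expected_cost_lower_bound_approx:
  fixes n :: nat and m :: real
  assumes u: "progressively_measurable \<F> T u" and lam: "0 < lam" and g: "0 \<le> g"
    and reach: "AE \<omega> in M. c < W T \<omega> \<longrightarrow> ennreal g \<le> (\<integral>\<^sup>+t. ennreal \<bar>u t \<omega>\<bar> \<partial>time_interval T)"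
    and K: "K = exp (lam * g / T)"
  shows "ennreal (lam * K * g * (1 - exp (c + T / 2 - n * m)))
    \<le> expected_cost M lam T u + ennreal (T * (K * (lam * g / T) - K + 1) + K * (n * m\<^sup>2))"
proof -
  interpret P: pair_sigma_finite "time_interval T" M by (rule pair_sigma_finite_interval)
  let ?\<tau> = "dyadic T" and ?L = "time_interval T"
  let ?w = "weight ?\<tau> m n" and ?A = "K * (lam * g / T) - K + 1"
  let ?H = "\<lambda>t. \<Sum>i<n. if ?\<tau> i < t then m\<^sup>2 / (2 * (?\<tau> (Suc i) - ?\<tau> i)) else 0"
  note \<tau> = strict_mono_dyadic[OF T] dyadic_0[of T]
  note weight_measurable[OF \<tau>, measurable]
  note progressively_measurable_joint[OF u, measurable]
  have [measurable]: "W T \<in> borel_measurable M" using T by (intro measurable_W) simp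
  have K_pos: "0 < K" and lnK: "ln K = lam * g / T" by (simp_all add: K)
  have A: "0 \<le> ?A"
    using mult_le_exp_plus_entropy[OF K_pos, of 0] by (simp add: lnK)
  have u_section [measurable]: "(\<lambda>t. u t \<omega>) \<in> borel_measurable ?L" if "\<omega> \<in> space M" for \<omega>
    using measurable_compose[OF measurable_Pair2'[OF that] progressively_measurable_joint[OF u]] by simp
  have "ennreal (lam * K * g * (1 - exp (c + T / 2 - n * m)))
      = ennreal (lam * K * g) * ennreal (1 - exp (c + T / 2 - n * m))"
    using lam g K_pos by (intro ennreal_mult') simp
  also have "\<dots> \<le> ennreal (lam * K * g) * (\<integral>\<^sup>+\<omega>. ?w \<omega> * indicator {\<omega>. c < W T \<omega>} \<omega> \<partial>M)"
    by (intro mult_left_mono weight_mass_above[OF \<tau>] dyadic_less[OF T] zero_le)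
  also have "\<dots> = (\<integral>\<^sup>+\<omega>. ennreal (lam * K * g) * (?w \<omega> * indicator {\<omega>. c < W T \<omega>} \<omega>) \<partial>M)"
    by (simp add: nn_integral_cmult)
  also have "\<dots> \<le> (\<integral>\<^sup>+\<omega>. (\<integral>\<^sup>+t. ennreal (K * (lam * \<bar>u t \<omega>\<bar>)) \<partial>?L) * ?w \<omega> \<partial>M)"
  proof (rule nn_integral_mono_AE)
    show "AE \<omega> in M. ennreal (lam * K * g) * ennreal (?w \<omega> * indicator {\<omega>. c < W T \<omega>} \<omega>)
        \<le> (\<integral>\<^sup>+t. ennreal (K * (lam * \<bar>u t \<omega>\<bar>)) \<partial>?L) * ?w \<omega>"
      using reach AE_space
    proof eventually_elim
      case (elim \<omega>)
      have "(\<integral>\<^sup>+t. ennreal (K * (lam * \<bar>u t \<omega>\<bar>)) \<partial>?L) = ennreal (lam * K) * (\<integral>\<^sup>+t. ennreal \<bar>u t \<omega>\<bar> \<partial>?L)"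
        using lam K_pos u_section[OF elim(2)]
        by (subst nn_integral_cmult[symmetric]) (auto simp: ennreal_mult[symmetric] mult_ac)
      moreover have "ennreal (lam * K * g) * ?w \<omega> \<le> (ennreal (lam * K) * (\<integral>\<^sup>+t. ennreal \<bar>u t \<omega>\<bar> \<partial>?L)) * ?w \<omega>"
        if "c < W T \<omega>"
        using that elim(1) lam K_pos g by (subst ennreal_mult) (auto intro!: mult_right_mono mult_left_mono)
      ultimately show ?case by (cases "c < W T \<omega>") auto
    qed
  qed
  also have "\<dots> = (\<integral>\<^sup>+\<omega>. (\<integral>\<^sup>+t. ennreal (K * (lam * \<bar>u t \<omega>\<bar>)) * ?w \<omega> \<partial>?L) \<partial>M)"
    by (intro nn_integral_cong nn_integral_multc[symmetric]) (use u_section in measurable)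
  \<comment> \<open>The order of integration is exchanged so that adaptedness of \<open>u t\<close>
    can be exploited at each fixed time.\<close>
  also have "\<dots> = (\<integral>\<^sup>+t. (\<integral>\<^sup>+\<omega>. ennreal (K * (lam * \<bar>u t \<omega>\<bar>)) * ?w \<omega> \<partial>M) \<partial>?L)"
    by (rule P.Fubini') simp
  also have "\<dots> \<le> (\<integral>\<^sup>+t. (\<integral>\<^sup>+\<omega>. ennreal (exp (lam * \<bar>u t \<omega>\<bar>) - 1) \<partial>M) + ennreal (?A + K * ?H t) \<partial>?L)"
  proof (rule nn_integral_mono)
    fix t assume "t \<in> space ?L"
    then have t: "t \<in> {0..T}" by (simp add: space_restrict_space)
    have [measurable]: "u t \<in> borel_measurable (\<F> t)" using u t by (rule progressively_measurable_section)
    show "(\<integral>\<^sup>+\<omega>. ennreal (K * (lam * \<bar>u t \<omega>\<bar>)) * ?w \<omega> \<partial>M)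
        \<le> (\<integral>\<^sup>+\<omega>. ennreal (exp (lam * \<bar>u t \<omega>\<bar>) - 1) \<partial>M) + ennreal (?A + K * ?H t)"
      using duality_at_time[OF \<tau>, of t "\<lambda>\<omega>. lam * \<bar>u t \<omega>\<bar>" K m n] t lam K_pos by (simp add: lnK)
  qed
  also have "\<dots> = (\<integral>\<^sup>+t. (\<integral>\<^sup>+\<omega>. ennreal (exp (lam * \<bar>u t \<omega>\<bar>) - 1) \<partial>M) \<partial>?L) + (\<integral>\<^sup>+t. ennreal (?A + K * ?H t) \<partial>?L)"
    by (intro nn_integral_add) (measurable, auto simp: measurable_restrict_space1)
  also have "(\<integral>\<^sup>+t. ennreal (?A + K * ?H t) \<partial>?L) = ennreal (T * ?A + K * (n * m\<^sup>2))"
    using T A K_pos by (intro nn_integral_dyadic_steps) auto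
  also have "(\<integral>\<^sup>+t. (\<integral>\<^sup>+\<omega>. ennreal (exp (lam * \<bar>u t \<omega>\<bar>) - 1) \<partial>M) \<partial>?L) = expected_cost M lam T u"
    unfolding expected_cost_interval by (rule P.Fubini'[symmetric]) simp
  finally show ?thesis .
qed

text \<open>The Young inequality is an equality at exponent \<open>lam * g / T\<close> and
  \<open>z = K\<close>, which is why this \<open>K\<close> makes the limiting bound equal to the
  cost of the constant control.\<close>

lemma expected_cost_lower_bound:
  assumes u: "progressively_measurable \<F> T u" and lam: "0 < lam" and g: "0 \<le> g"
    and reach: "AE \<omega> in M. c < W T \<omega> \<longrightarrow> ennreal g \<le> (\<integral>\<^sup>+t. ennreal \<bar>u t \<omega>\<bar> \<partial>time_interval T)"
  shows "ennreal (T * (exp (lam * g / T) - 1)) \<le> expected_cost M lam T u"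
proof (cases "expected_cost M lam T u")
  case (real r)
  define K where "K = exp (lam * g / T)"
  let ?A = "K * (lam * g / T) - K + 1"
  have K_pos: "0 < K" by (simp add: K_def)
  have A: "0 \<le> ?A"
    using mult_le_exp_plus_entropy[of K 0] by (simp add: K_def)
  \<comment> \<open>With \<open>n = (k + 1)^3\<close> and \<open>m = (k + 1)^(-2)\<close> the shift \<open>n m\<close> diverges and the entropy \<open>n m\<^sup>2\<close> vanishes.\<close>
  have bound: "lam * K * g * (1 - exp (c + T / 2 - Suc k)) \<le> r + (T * ?A + K * inverse (Suc k))" for k :: nat
  proof -
    let ?x = "real (Suc k)"
    have x: "real (Suc k ^ 3) * (1 / ?x\<^sup>2) = ?x" "real (Suc k ^ 3) * (1 / ?x\<^sup>2)\<^sup>2 = inverse ?x"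
      by (simp_all only: of_nat_power) (simp_all add: power2_eq_square power3_eq_cube field_simps del: of_nat_Suc)
    have nonneg: "0 \<le> T * ?A + K * inverse ?x"
      using T K_pos by (intro add_nonneg_nonneg mult_nonneg_nonneg A) simp_all
    from expected_cost_lower_bound_approx[OF u lam g reach K_def, of "Suc k ^ 3" "1 / ?x\<^sup>2"]
    have "ennreal (lam * K * g * (1 - exp (c + T / 2 - ?x))) \<le> ennreal (r + (T * ?A + K * inverse ?x))"
      unfolding x using real nonneg by (simp add: ennreal_plus)
    then show ?thesis
      using real nonneg by (subst (asm) ennreal_le_iff) auto
  qed
  have "(\<lambda>k. exp (c + T / 2 - real (Suc k))) \<longlonglongrightarrow> 0" by real_asymp
  then have "(\<lambda>k. lam * K * g * (1 - exp (c + T / 2 - real (Suc k)))) \<longlonglongrightarrow> lam * K * g * (1 - 0)"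
    by (intro tendsto_intros)
  moreover have "(\<lambda>k. r + (T * ?A + K * inverse (real (Suc k)))) \<longlonglongrightarrow> r + (T * ?A + K * 0)"
    by (intro tendsto_intros LIMSEQ_inverse_real_of_nat)
  ultimately have "lam * K * g * (1 - 0) \<le> r + (T * ?A + K * 0)"
    using bound by (intro LIMSEQ_le) auto
  \<comment> \<open>The entropy constant consumes all of \<open>lam * K * g\<close> except
    \<open>T * (K - 1)\<close>.\<close>
  moreover have "T * ?A = lam * K * g - T * (K - 1)" using T by (simp add: field_simps)
  ultimately have "T * (K - 1) \<le> r" by simp
  then show ?thesis using real by (simp add: K_def ennreal_leI)
qed simp

section \<open>Admissible controls: reach, the constant control and midpoints\<close>

lemma admissible_reach:
  assumes "u \<in> admissible M W T x c"
  shows "AE \<omega> in M. c < W T \<omega> \<longrightarrow> ennreal (max (1 - x) 0) \<le> (\<integral>\<^sup>+t. ennreal \<bar>u t \<omega>\<bar> \<partial>time_interval T)"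
proof -
  have "AE \<omega> in M. controlled_state x u T \<omega> \<ge> indicator {\<omega>'. W T \<omega>' > c} \<omega>"
    using assms by (simp add: admissible_def)
  then show ?thesis
  proof eventually_elim
    case (elim \<omega>)
    let ?f = "\<lambda>t. indicator {0..T} t *\<^sub>R u t \<omega>"
    show ?case
    proof
      assume "c < W T \<omega>"
      with elim have ge: "1 - x \<le> (\<integral>t. ?f t \<partial>lborel)"
        by (simp add: controlled_state_def set_lebesgue_integral_def)
      show "ennreal (max (1 - x) 0) \<le> (\<integral>\<^sup>+t. ennreal \<bar>u t \<omega>\<bar> \<partial>time_interval T)"
      proof (cases "integrable lborel ?f")
        case True
        have "ennreal (max (1 - x) 0) \<le> ennreal (norm (\<integral>t. ?f t \<partial>lborel))"
          using ge by (intro ennreal_leI) auto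
        also have "\<dots> \<le> (\<integral>\<^sup>+t. norm (?f t) \<partial>lborel)"
          using True by (rule integral_norm_bound_ennreal)
        also have "\<dots> = (\<integral>\<^sup>+t. ennreal \<bar>u t \<omega>\<bar> \<partial>time_interval T)"
          by (subst nn_integral_restrict_space) (auto intro!: nn_integral_cong simp: indicator_def)
        finally show ?thesis .
      next
        \<comment> \<open>A non-integrable path has integral 0 by convention, so \<open>ge\<close>
          gives \<open>1 - x \<le> 0\<close> and the required reach is 0.\<close>
        case False
        then show ?thesis using ge by (simp add: not_integrable_integral_eq)
      qed
    qed
  qed
qed

lemma expected_cost_admissible:
  assumes "u \<in> admissible M W T x c" "0 < lam"
  shows "ennreal (T * (exp (lam * max (1 - x) 0 / T) - 1)) \<le> expected_cost M lam T u"
  using assms by (intro expected_cost_lower_bound[OF _ _ _ admissible_reach]) (auto simp: admissible_def)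

text \<open>This control ends at \<open>max x 1\<close> on every path, which dominates the indicator
  whatever \<open>W T\<close> is.\<close>

lemma constant_admissible: "(\<lambda>t \<omega>. max (1 - x) 0 / T) \<in> admissible M W T x c"
proof -
  let ?k = "max (1 - x) 0 / T"
  have "(\<integral>\<^sup>+t\<in>{0..T}. ennreal \<bar>?k\<bar> \<partial>lborel) < \<infinity>"
    by (subst nn_integral_cmult_indicator) (simp_all add: ennreal_mult_less_top emeasure_lborel_Icc_eq)
  moreover have "controlled_state x (\<lambda>t \<omega>. ?k) T \<omega> = x + max (1 - x) 0" for \<omega> :: 'a
    using T by (simp add: controlled_state_def set_lebesgue_integral_def)
  then have "indicator {\<omega>'. W T \<omega>' > c} \<omega> \<le> controlled_state x (\<lambda>t \<omega>. ?k) T \<omega>" for \<omega>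
    unfolding \<open>\<And>\<omega> :: 'a. controlled_state x (\<lambda>t \<omega>. ?k) T \<omega> = x + max (1 - x) 0\<close> by (auto simp: indicator_def max_def)
  ultimately show ?thesis
    unfolding admissible_def progressively_measurable_def mem_Collect_eq by (intro conjI AE_I2) simp_all
qed

lemma constant_cost:
  assumes "0 \<le> lam" "0 \<le> k"
  shows "expected_cost M lam T (\<lambda>t \<omega>. k) = ennreal (T * (exp (lam * k) - 1))"
proof -
  have "(\<integral>\<^sup>+t\<in>{0..T}. ennreal (exp (lam * k) - 1) \<partial>lborel) = ennreal (exp (lam * k) - 1) * ennreal T"
    using T by (subst nn_integral_cmult_indicator) simp_all
  also have "\<dots> = ennreal (T * (exp (lam * k) - 1))"
    using T assms by (subst ennreal_mult[symmetric]) (simp_all add: mult.commute)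
  finally show ?thesis
    using assms by (simp add: expected_cost_def emeasure_space_1)
qed

lemma midpoint_admissible:
  assumes u: "u \<in> admissible M W T x c" and v: "v \<in> admissible M W T x c"
  shows "(\<lambda>t \<omega>. (u t \<omega> + v t \<omega>) / 2) \<in> admissible M W T x c"
proof -
  \<comment> \<open>Integrability of both paths is what lets the integral of the sum split; the
    terminal state of the midpoint is then the average of the two terminal states.\<close>
  have int: "AE \<omega> in M. set_integrable lborel {0..T} (\<lambda>t. w t \<omega>)" if w: "w \<in> admissible M W T x c" for w
  proof -
    have "AE \<omega> in M. (\<integral>\<^sup>+t\<in>{0..T}. ennreal \<bar>w t \<omega>\<bar> \<partial>lborel) < \<infinity>" and pm: "progressively_measurable \<F> T w"
      using w by (auto simp: admissible_def)
    from this(1) AE_space show ?thesis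
    proof eventually_elim
      case (elim \<omega>)
      have "(\<lambda>t. w t \<omega>) \<in> borel_measurable (time_interval T)"
        using measurable_compose[OF measurable_Pair2'[OF elim(2)] progressively_measurable_joint[OF pm]] by simp
      then have "(\<lambda>t. indicator {0..T} t *\<^sub>R w t \<omega>) \<in> borel_measurable lborel"
        by (subst (asm) borel_measurable_restrict_space_iff) auto
      moreover have "(\<integral>\<^sup>+t. norm (indicator {0..T} t *\<^sub>R w t \<omega>) \<partial>lborel) < \<infinity>"
        using elim(1) by (subst nn_integral_cong[where v="\<lambda>t. ennreal \<bar>w t \<omega>\<bar> * indicator {0..T} t"]) (auto simp: indicator_def)
      ultimately show ?case unfolding set_integrable_def by (intro integrableI_bounded)
    qed
  qed
  let ?z = "\<lambda>t \<omega>. (u t \<omega> + v t \<omega>) / 2"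
  have "progressively_measurable \<F> T ?z"
  proof -
    have "(\<lambda>(s, \<omega>). ?z s \<omega>) \<in> borel_measurable (restrict_space borel {0..t} \<Otimes>\<^sub>M \<F> t)" if "t \<in> {0..T}" for t
    proof -
      have [measurable]: "(\<lambda>(s, \<omega>). u s \<omega>) \<in> borel_measurable (restrict_space borel {0..t} \<Otimes>\<^sub>M \<F> t)"
        "(\<lambda>(s, \<omega>). v s \<omega>) \<in> borel_measurable (restrict_space borel {0..t} \<Otimes>\<^sub>M \<F> t)"
        using u v that by (auto simp: admissible_def progressively_measurable_def)
      show ?thesis by measurable
    qed
    then show ?thesis by (simp add: progressively_measurable_def)
  qed
  moreover have "AE \<omega> in M. set_integrable lborel {0..T} (\<lambda>t. ?z t \<omega>)"
    using int[OF u] int[OF v] by eventually_elim simp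
  then have "AE \<omega> in M. (\<integral>\<^sup>+t\<in>{0..T}. ennreal \<bar>?z t \<omega>\<bar> \<partial>lborel) < \<infinity>"
  proof eventually_elim
    case (elim \<omega>)
    then have "(\<integral>\<^sup>+t. norm (indicator {0..T} t *\<^sub>R ?z t \<omega>) \<partial>lborel) < \<infinity>"
      by (simp only: set_integrable_def integrable_iff_bounded)
    then show ?case
      by (subst nn_integral_cong[where v="\<lambda>t. ennreal (norm (indicator {0..T} t *\<^sub>R ?z t \<omega>))"]) (auto simp: indicator_def)
  qed
  moreover have "AE \<omega> in M. controlled_state x u T \<omega> \<ge> indicator {\<omega>'. W T \<omega>' > c} \<omega>"
    "AE \<omega> in M. controlled_state x v T \<omega> \<ge> indicator {\<omega>'. W T \<omega>' > c} \<omega>"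
    using u v by (auto simp: admissible_def)
  with int[OF u] int[OF v] have "AE \<omega> in M. controlled_state x ?z T \<omega> \<ge> indicator {\<omega>'. W T \<omega>' > c} \<omega>"
  proof eventually_elim
    case (elim \<omega>)
    have "controlled_state x ?z T \<omega> = (controlled_state x u T \<omega> + controlled_state x v T \<omega>) / 2"
    proof -
      have "(LINT t:{0..T}|lborel. ?z t \<omega>) = ((LINT t:{0..T}|lborel. u t \<omega>) + (LINT t:{0..T}|lborel. v t \<omega>)) / 2"
        using elim(1,2) by simp
      then show ?thesis by (simp add: controlled_state_def field_simps)
    qed
    then show ?case using elim(3,4) by simp
  qed
  ultimately show ?thesis by (simp add: admissible_def)
qed

section \<open>Uniqueness of the optimal control\<close>

text \<open>The midpoint of \<open>u\<close> and the constant control is admissible, so it costs at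
  least the optimal value, while convexity bounds its cost by the average of two optimal costs. The
  convexity gap thus has integral 0, and strict convexity identifies \<open>u\<close> almost
  everywhere.\<close>

lemma optimal_control_unique:
  fixes x :: real
  defines "k \<equiv> max (1 - x) 0 / T"
  assumes lam: "0 < lam" and u: "u \<in> admissible M W T x c"
    and cost: "expected_cost M lam T u = ennreal (T * (exp (lam * k) - 1))"
  shows "AE (t, \<omega>) in time_interval T \<Otimes>\<^sub>M M. u t \<omega> = k"
proof -
  interpret P: pair_sigma_finite "time_interval T" M by (rule pair_sigma_finite_interval)
  let ?N = "time_interval T \<Otimes>\<^sub>M M"
  let ?z = "\<lambda>t \<omega>. (u t \<omega> + k) / 2"
  let ?C = "T * (exp (lam * k) - 1)"
  have k: "0 \<le> k" using T by (simp add: k_def)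
  have joint: "(\<lambda>(t, \<omega>). w t \<omega>) \<in> borel_measurable ?N" if "w \<in> admissible M W T x c" for w
    using that by (intro progressively_measurable_joint) (auto simp: admissible_def)
  have cost_N: "expected_cost M lam T w = (\<integral>\<^sup>+p. ennreal (exp (lam * \<bar>case_prod w p\<bar>) - 1) \<partial>?N)"
    if "w \<in> admissible M W T x c" for w
  proof -
    note joint[OF that, measurable]
    show ?thesis
      unfolding expected_cost_interval
      using P.nn_integral_snd[of "\<lambda>p. ennreal (exp (lam * \<bar>case_prod w p\<bar>) - 1)"] by simp
  qed
  have k_adm: "(\<lambda>t \<omega>. k) \<in> admissible M W T x c" unfolding k_def by (rule constant_admissible)
  have z: "?z \<in> admissible M W T x c" using u k_adm by (rule midpoint_admissible)
  have z_cost: "ennreal ?C \<le> expected_cost M lam T ?z"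
    using expected_cost_admissible[OF z lam] by (simp add: k_def)
  note [measurable] = joint[OF u] joint[OF z]
  \<comment> \<open>\<open>a\<close> and \<open>b\<close> are the running costs of \<open>u\<close>
    and of the midpoint; \<open>d\<close> is the convexity gap.\<close>
  define a b d where "a p = exp (lam * \<bar>case_prod u p\<bar>) - 1" and "b p = exp (lam * \<bar>case_prod ?z p\<bar>) - 1"
    and "d p = (a p + (exp (lam * k) - 1)) / 2 - b p" for p
  have nonneg: "0 \<le> a p" "0 \<le> b p" for p using lam by (simp_all add: a_def b_def split: prod.split)
  have d_nonneg: "0 \<le> d p" for p
    using midpoint_exp_abs[OF lam k, of "case_prod u p"] by (cases p) (simp add: d_def a_def b_def field_simps)
  have [measurable]: "a \<in> borel_measurable ?N" "b \<in> borel_measurable ?N" "d \<in> borel_measurable ?N"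
    unfolding a_def b_def d_def by measurable
  have C_nonneg: "0 \<le> ?C" using T lam k by simp
  \<comment> \<open>Adding the gap to the midpoint cost keeps all integrals nonnegative and avoids
    subtraction of extended reals.\<close>
  have "(\<integral>\<^sup>+p. ennreal (b p) \<partial>?N) + (\<integral>\<^sup>+p. ennreal (d p) \<partial>?N)
      = (\<integral>\<^sup>+p. ennreal (1 / 2) * (ennreal (a p) + ennreal (exp (lam * k) - 1)) \<partial>?N)"
  proof (subst nn_integral_add[symmetric])
    have "ennreal (b p) + ennreal (d p) = ennreal (1 / 2) * (ennreal (a p) + ennreal (exp (lam * k) - 1))" for p
    proof -
      have "ennreal (b p) + ennreal (d p) = ennreal (b p + d p)"
        using nonneg d_nonneg by (simp only: ennreal_plus)
      also have "b p + d p = 1 / 2 * (a p + (exp (lam * k) - 1))" by (simp add: d_def)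
      also have "ennreal \<dots> = ennreal (1 / 2) * ennreal (a p + (exp (lam * k) - 1))"
        by (rule ennreal_mult') simp
      also have "ennreal (a p + (exp (lam * k) - 1)) = ennreal (a p) + ennreal (exp (lam * k) - 1)"
        using nonneg lam k by (intro ennreal_plus) simp_all
      finally show ?thesis .
    qed
    then show "(\<integral>\<^sup>+p. ennreal (b p) + ennreal (d p) \<partial>?N)
        = (\<integral>\<^sup>+p. ennreal (1 / 2) * (ennreal (a p) + ennreal (exp (lam * k) - 1)) \<partial>?N)" by simp
  qed simp_all
  also have "\<dots> = ennreal (1 / 2) * (expected_cost M lam T u + expected_cost M lam T (\<lambda>t \<omega>. k))"
    unfolding cost_N[OF u] cost_N[OF k_adm] using k
    by (subst nn_integral_cmult, simp, subst nn_integral_add) (auto simp: a_def case_prod_unfold)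
  also have "\<dots> = ennreal ?C"
  proof -
    have "ennreal (1 / 2) * (ennreal ?C + ennreal ?C) = ennreal (1 / 2) * ennreal (?C + ?C)"
      using C_nonneg by (simp only: ennreal_plus)
    also have "\<dots> = ennreal (1 / 2 * (?C + ?C))"
      by (rule ennreal_mult'[symmetric]) simp
    also have "1 / 2 * (?C + ?C) = ?C" by simp
    finally show ?thesis using constant_cost[of lam k] lam k cost by simp
  qed
  finally have sum: "(\<integral>\<^sup>+p. ennreal (b p) \<partial>?N) + (\<integral>\<^sup>+p. ennreal (d p) \<partial>?N) = ennreal ?C" .
  have "ennreal ?C \<le> (\<integral>\<^sup>+p. ennreal (b p) \<partial>?N)"
    using z_cost unfolding cost_N[OF z] by (simp add: b_def)
  then have "ennreal ?C + (\<integral>\<^sup>+p. ennreal (d p) \<partial>?N) \<le> ennreal ?C + 0"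
    using sum by (metis add.right_neutral add_right_mono)
  \<comment> \<open>The optimal value is finite and may be cancelled.\<close>
  then have "(\<integral>\<^sup>+p. ennreal (d p) \<partial>?N) = 0"
    by (simp add: ennreal_add_left_cancel_le)
  then have "AE p in ?N. ennreal (d p) = 0"
    by (subst (asm) nn_integral_0_iff_AE) auto
  then show ?thesis
  proof eventually_elim
    case (elim p)
    then have "d p \<le> 0" by (rule iffD1[OF ennreal_eq_0_iff])
    then have "case_prod u p = k"
      by (intro strict_convexity_exp_abs[OF lam k]) (simp add: d_def a_def b_def field_simps split: prod.splits)
    then show ?case by (cases p) simp
  qed
qed

end

end

section \<open>Identification of the value and of the optimal control\<close>

theorem theorem3p1:
  fixes M :: "'a measure" and W :: "real \<Rightarrow> 'a \<Rightarrow> real" and lam T x c :: real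
  assumes "standard_brownian_motion M W"
    and "complete_measure M"
    and "lam > 0" and "T > 0"
  shows "value_function M W lam T x c = ennreal (T * (exp (lam * max (1 - x) 0 / T) - 1))
    \<and> optimal_control M W lam T x c (\<lambda>t \<omega>. max (1 - x) 0 / T)
    \<and> (\<forall>u. optimal_control M W lam T x c u \<longrightarrow>
          (AE (t, \<omega>) in restrict_space lborel {0..T} \<Otimes>\<^sub>M M. u t \<omega> = max (1 - x) 0 / T))"
proof -
  interpret standard_brownian_motion M W by fact
  let ?k = "max (1 - x) 0 / T"
  note adm = constant_admissible[OF \<open>T > 0\<close>, of x c]
  have cost: "expected_cost M lam T (\<lambda>t \<omega>. ?k) = ennreal (T * (exp (lam * max (1 - x) 0 / T) - 1))"
    using constant_cost[OF \<open>T > 0\<close>, of lam ?k] assms(3,4) by simp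
  have val: "value_function M W lam T x c = ennreal (T * (exp (lam * max (1 - x) 0 / T) - 1))"
    unfolding value_function_def
  proof (rule antisym)
    show "(INF u\<in>admissible M W T x c. expected_cost M lam T u) \<le> ennreal (T * (exp (lam * max (1 - x) 0 / T) - 1))"
      using adm cost by (metis INF_lower)
    show "ennreal (T * (exp (lam * max (1 - x) 0 / T) - 1)) \<le> (INF u\<in>admissible M W T x c. expected_cost M lam T u)"
      using assms(3,4) by (intro INF_greatest expected_cost_admissible)
  qed
  moreover have "optimal_control M W lam T x c (\<lambda>t \<omega>. ?k)"
    unfolding optimal_control_def val using adm cost by simp
  moreover have "AE (t, \<omega>) in restrict_space lborel {0..T} \<Otimes>\<^sub>M M. u t \<omega> = ?k"
    if "optimal_control M W lam T x c u" for u
    using that assms(3,4) unfolding optimal_control_def val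
    by (intro optimal_control_unique[where lam=lam and c=c]) auto
  ultimately show ?thesis by blast
qed

end
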